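(* Let $A$ be a linearly ordered alphabet with $|A|=k$, and let $P\subset A^*$ be a finite maximal prefix code. Then $S=\bigcup_{n\ge1}\mathfrak{S}_{PA^n}$ is a subgroup of $G_{k,1}$, and $G_{k,1}=S\cdot F_{k,1}$. Moreover $S\cap F_{k,1}=\{\mathbf{1}\}$, hence every element of $G_{k,1}$ has a unique factorization $\pi f$ with $\pi\in S$, $f\in F_{k,1}$. The group $T_{k,1}$ has the subgroup $Z=\bigcup_{n\ge1}\mathbb{Z}_{PA^n}$, and $T_{k,1}=Z\cdot F_{k,1}$, with unique factorization for every element of $T_{k,1}$.
   Context: Fix a finite linearly ordered alphabet $A$ with $|A|=k\ge 2$; $A^*$ is the set of finite words over $A$. A right ideal of $A^*$ is a set $R$ with $RA^*\subseteq R$; it is essential if it meets every non-empty right ideal. Every right ideal has a unique minimal generating set, which is a prefix code; it is a maximal prefix code iff the right ideal is essential. An isomorphism $\varphi:R_1\to R_2$ between right ideals is a bijection with $\varphi(rz)=\varphi(r)z$ for all $r\in R_1$, $z\in A^*$. Every isomorphism between finitely generated essential right ideals has a unique maximal extension to an isomorphism between essential right ideals. $G_{k,1}$ is the group of all maximally extended isomorphisms between finitely generated essential right ideals of $A^*$, with multiplication: composition (acting on the left) followed by maximal extension. A bijection $P\to Q$ between finite maximal prefix codes represents the element of $G_{k,1}$ obtained by extending it to $PA^*\to QA^*$, $pz\mapsto\varphi(p)z$, and then maximally. $\mathbf 1$ is the identity. For a finite maximal prefix code $Q$, $\mathfrak{S}_Q$ denotes the symmetric group on $Q$, viewed as a subgroup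 of $G_{k,1}$ in this way; the map $\pi\mapsto\pi\otimes\mathrm{id}_A$, $(\pi\otimes\mathrm{id}_A)(xa)=\pi(x)a$, identifies $\mathfrak{S}_{PA^n}$ with a subgroup of $\mathfrak{S}_{PA^{n+1}}$, and $\bigcup_n\mathfrak{S}_{PA^n}$ is the resulting direct limit (union in $G_{k,1}$). $\mathbb{Z}_Q\subseteq\mathfrak{S}_Q$ is the cyclic group generated by $w_i\mapsto w_{(i+1)\bmod|Q|}$, where $(w_0,\dots,w_{|Q|-1})$ lists $Q$ in dictionary order. Dictionary order: $x_1\le_d x_2$ iff $x_1$ is a prefix of $x_2$, or $x_1=pa_1v_1$, $x_2=pa_2v_2$ with $p$ the longest common prefix and letters $a_1<a_2$. $F_{k,1}$: elements of $G_{k,1}$ preserving the dictionary order on their domain. A cyclical order of a finite maximal prefix code is a cyclic permutation of its listing in dictionary order; $T_{k,1}$: elements $\varphi\in G_{k,1}$ that cyclically preserve the dictionary order (a finite sequence $(x_i)$ in $\mathrm{Dom}(\varphi)$ is a cyclical order of some finite maximal prefix code iff $(\varphi(x_i))$ is). *)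

theory Defs
  imports
    "HOL-Algebra.Generated_Groups"
    "HOL-Combinatorics.Permutations"
    "HOL-Library.List_Lexorder"
    "HOL-Library.Sublist"
begin

text \<open>
  The alphabet is the type \<open>'a\<close> and words are lists. Through \<open>List_Lexorder\<close>, \<open>\<le>\<close> on words is the
  dictionary order (a prefix is smaller than its extensions), and \<open>sorted_list_of_set Q\<close> is the
  listing of a finite set \<open>Q\<close> of words in dictionary order.
\<close>

definition right_ideal :: "'a list set \<Rightarrow> bool" where
  "right_ideal R \<longleftrightarrow> (\<forall>r\<in>R. \<forall>z. r @ z \<in> R)"

definition essential :: "'a list set \<Rightarrow> bool" where
  "essential R \<longleftrightarrow> right_ideal R \<and> (\<forall>R'. right_ideal R' \<and> R' \<noteq> {} \<longrightarrow> R \<inter> R' \<noteq> {})"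

definition ideal_gen :: "'a list set \<Rightarrow> 'a list set" where
  "ideal_gen P = {p @ z | p z. p \<in> P}"

definition fin_gen :: "'a list set \<Rightarrow> bool" where
  "fin_gen R \<longleftrightarrow> (\<exists>P. finite P \<and> R = ideal_gen P)"

definition prefix_code :: "'a list set \<Rightarrow> bool" where
  "prefix_code P \<longleftrightarrow> (\<forall>x\<in>P. \<forall>y\<in>P. prefix x y \<longrightarrow> x = y)"

definition maximal_prefix_code :: "'a list set \<Rightarrow> bool" where
  "maximal_prefix_code P \<longleftrightarrow> prefix_code P \<and> (\<forall>Q. prefix_code Q \<and> P \<subseteq> Q \<longrightarrow> Q = P)"


subsection \<open>Isomorphisms of right ideals, as partial maps on words\<close>

definition ideal_iso :: "('a list \<rightharpoonup> 'a list) \<Rightarrow> 'a list set \<Rightarrow> 'a list set \<Rightarrow> bool" where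
  "ideal_iso \<phi> R1 R2 \<longleftrightarrow>
     right_ideal R1 \<and> right_ideal R2 \<and> dom \<phi> = R1 \<and> bij_betw (\<lambda>x. the (\<phi> x)) R1 R2 \<and>
     (\<forall>r\<in>R1. \<forall>z. the (\<phi> (r @ z)) = the (\<phi> r) @ z)"

definition essential_iso :: "('a list \<rightharpoonup> 'a list) \<Rightarrow> bool" where
  "essential_iso \<phi> \<longleftrightarrow> (\<exists>R1 R2. essential R1 \<and> essential R2 \<and> ideal_iso \<phi> R1 R2)"

definition fg_essential_iso :: "('a list \<rightharpoonup> 'a list) \<Rightarrow> bool" where
  "fg_essential_iso \<phi> \<longleftrightarrow>
     (\<exists>R1 R2. essential R1 \<and> fin_gen R1 \<and> essential R2 \<and> fin_gen R2 \<and> ideal_iso \<phi> R1 R2)"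

definition maximal_iso :: "('a list \<rightharpoonup> 'a list) \<Rightarrow> bool" where
  "maximal_iso \<phi> \<longleftrightarrow> essential_iso \<phi> \<and> (\<forall>\<psi>. essential_iso \<psi> \<and> \<phi> \<subseteq>\<^sub>m \<psi> \<longrightarrow> \<psi> = \<phi>)"

definition max_ext :: "('a list \<rightharpoonup> 'a list) \<Rightarrow> ('a list \<rightharpoonup> 'a list)" where
  "max_ext \<phi> = (THE \<psi>. maximal_iso \<psi> \<and> \<phi> \<subseteq>\<^sub>m \<psi>)"


subsection \<open>The group $G_{k,1}$\<close>

definition thompson_G :: "('a list \<rightharpoonup> 'a list) monoid" where
  "thompson_G = \<lparr>carrier = {\<phi>. fg_essential_iso \<phi> \<and> maximal_iso \<phi>},
                 monoid.mult = (\<lambda>\<phi> \<psi>. max_ext (\<phi> \<circ>\<^sub>m \<psi>)),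
                 one = Some\<rparr>"

text \<open>
  The extension of a map \<open>f\<close> on a prefix code \<open>P\<close> to \<open>ideal_gen P\<close>: each word \<open>p @ z\<close> with \<open>p \<in> P\<close>
  goes to \<open>f p @ z\<close>.
\<close>

definition code_ext :: "'a list set \<Rightarrow> ('a list \<Rightarrow> 'a list) \<Rightarrow> ('a list \<rightharpoonup> 'a list)" where
  "code_ext P f w =
     (if w \<in> ideal_gen P
      then let p = (THE p. p \<in> P \<and> prefix p w) in Some (f p @ drop (length p) w)
      else None)"

definition represented :: "'a list set \<Rightarrow> ('a list \<Rightarrow> 'a list) \<Rightarrow> ('a list \<rightharpoonup> 'a list)" where
  "represented P f = max_ext (code_ext P f)"

definition code_power :: "'a list set \<Rightarrow> nat \<Rightarrow> 'a list set" where
  "code_power P n = {p @ w | p w. p \<in> P \<and> length w = n}"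

definition Sym_code :: "'a list set \<Rightarrow> ('a list \<rightharpoonup> 'a list) set" where
  "Sym_code Q = {represented Q \<pi> | \<pi>. \<pi> permutes Q}"

definition dict_rot :: "'a::linorder list set \<Rightarrow> 'a list \<Rightarrow> 'a list" where
  "dict_rot Q w =
     (let ws = sorted_list_of_set Q; i = (THE i. i < card Q \<and> ws ! i = w)
      in ws ! ((i + 1) mod card Q))"

definition Cyc_code :: "'a::linorder list set \<Rightarrow> ('a list \<rightharpoonup> 'a list) set" where
  "Cyc_code Q = generate thompson_G {represented Q (dict_rot Q)}"

definition Sym_union :: "'a list set \<Rightarrow> ('a list \<rightharpoonup> 'a list) set" where
  "Sym_union P = (\<Union>n\<in>{1..}. Sym_code (code_power P n))"

definition Cyc_union :: "'a::linorder list set \<Rightarrow> ('a list \<rightharpoonup> 'a list) set" where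
  "Cyc_union P = (\<Union>n\<in>{1..}. Cyc_code (code_power P n))"


subsection \<open>The groups $F_{k,1}$ and $T_{k,1}$\<close>

definition thompson_F :: "('a::linorder list \<rightharpoonup> 'a list) set" where
  "thompson_F = {\<phi> \<in> carrier thompson_G.
     \<forall>x\<in>dom \<phi>. \<forall>y\<in>dom \<phi>. x \<le> y \<longrightarrow> the (\<phi> x) \<le> the (\<phi> y)}"

definition cyclical_order :: "'a::linorder list list \<Rightarrow> 'a list set \<Rightarrow> bool" where
  "cyclical_order xs Q \<longleftrightarrow> (\<exists>j. xs = rotate j (sorted_list_of_set Q))"

definition cyclical_code_order :: "'a::linorder list list \<Rightarrow> bool" where
  "cyclical_code_order xs \<longleftrightarrow> (\<exists>Q. finite Q \<and> maximal_prefix_code Q \<and> cyclical_order xs Q)"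

definition thompson_T :: "('a::linorder list \<rightharpoonup> 'a list) set" where
  "thompson_T = {\<phi> \<in> carrier thompson_G.
     \<forall>xs. set xs \<subseteq> dom \<phi> \<longrightarrow>
       (cyclical_code_order xs \<longleftrightarrow> cyclical_code_order (map (\<lambda>x. the (\<phi> x)) xs))}"

end

theory Submission
  imports Defs
begin

text \<open>
  An element of \<open>G\<close> is determined by its values on all sufficiently long words; this replaces
  computations with maximal extensions by computations up to finitely many words.

  Given \<open>g\<close> in \<open>G\<close>, choose \<open>n\<close> such that \<open>PA\<^sup>n\<close> lies in the image of \<open>g\<close>, and let \<open>Q\<close> be the
  inverse image of \<open>PA\<^sup>n\<close>, again a finite maximal prefix code. The order-preserving bijection
  \<open>Q \<rightarrow> PA\<^sup>n\<close> represents an element \<open>f\<close> of \<open>F\<close>, and \<open>g f\<^sup>-\<^sup>1\<close> permutes \<open>PA\<^sup>n\<close>. Uniqueness holds because an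
  order-preserving permutation of a finite chain is trivial. For \<open>T\<close> one notes that a permutation of a
  finite maximal prefix code lies in \<open>T\<close> iff it is a rotation of the dictionary listing; hence
  \<open>Z = S \<inter> T\<close>, and the factorization in \<open>T\<close> follows from the one in \<open>G\<close> since \<open>F \<subseteq> T\<close>.
\<close>

section \<open>Right ideals and their isomorphisms\<close>

text \<open>The product of \<open>thompson_G\<close> contains a maximal extension, and
  \<open>max_ext\<close> is a definite description, so neither can be computed with directly. Over a
  finite alphabet a right ideal is essential and finitely generated iff it contains all but finitely
  many words. With the filter \<open>long_words\<close>, isomorphisms become partial maps that are
  eventually defined and eventually onto, and identities in the group become eventual equalities,
  from which a common suffix is cancelled at the end. A second obstacle is that the order conditions
  refer to the whole domain of a maximal extension, while elements are built on a single code.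
  Appending a common suffix can reverse the order of a word and its extension:
  \<open>[] < [a]\<close>, but \<open>[b] > [a, b]\<close> if \<open>a < b\<close>. Hence both
  conditions are rephrased for pairwise incomparable words. For \<open>T\<close>, defined only
  through complete codes, this takes a ternary cyclic order and the completion of any incomparable
  triple to a code inside the domain. One argument then makes \<open>F\<close> and \<open>T\<close>
  subgroups.\<close>

definition long_words :: "'a list filter" where
  "long_words = filtercomap length at_top"

lemma eventually_long_words:
  "eventually P long_words \<longleftrightarrow> (\<exists>N. \<forall>w. N \<le> length w \<longrightarrow> P w)"
  by (auto simp: long_words_def eventually_filtercomap_at_top_linorder)

lemma long_words_neq_bot: "(long_words :: 'a list filter) \<noteq> bot"
proof
  assume "(long_words :: 'a list filter) = bot"
  then have "eventually (\<lambda>w :: 'a list. False) long_words" by simp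
  then obtain N where "\<And>w :: 'a list. N \<le> length w \<Longrightarrow> False"
    by (auto simp: eventually_long_words)
  from this[of "replicate N undefined"] show False by simp
qed

lemma eventually_long_wordsE:
  assumes "eventually P long_words"
  obtains w where "P w"
  using eventually_happens'[OF long_words_neq_bot assms] by blast

lemma filterlim_append: "filterlim (\<lambda>z. x @ z) long_words long_words"
  unfolding filterlim_iff eventually_long_words by (metis length_append trans_le_add2)

lemma eventually_append:
  "eventually P long_words \<Longrightarrow> eventually (\<lambda>z. P (x @ z)) long_words"
  using filterlim_append filterlim_iff by blast

lemma eventually_in_mono:
  "A \<subseteq> B \<Longrightarrow> \<forall>\<^sub>F x in F. x \<in> A \<Longrightarrow> \<forall>\<^sub>F x in F. x \<in> B"
  by (rule eventually_mono) blast+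

lemma right_ideal_ideal_gen: "right_ideal (ideal_gen P)"
  unfolding right_ideal_def ideal_gen_def by force

text \<open>It suffices to test against the principal ideals \<open>ideal_gen {w}\<close>, since
  every nonempty right ideal contains one.\<close>

lemma essential_iff: "essential R \<longleftrightarrow> right_ideal R \<and> (\<forall>w. \<exists>z. w @ z \<in> R)"
proof -
  have "\<exists>z. w @ z \<in> R" if "essential R" for w
  proof -
    have "ideal_gen {w} \<noteq> {}" by (auto simp: ideal_gen_def)
    then have "R \<inter> ideal_gen {w} \<noteq> {}"
      using that right_ideal_ideal_gen[of "{w}"] unfolding essential_def by blast
    then show ?thesis by (auto simp: ideal_gen_def)
  qed
  moreover have "R \<inter> R' \<noteq> {}"
    if *: "\<forall>w. \<exists>z. w @ z \<in> R" and R': "right_ideal R'" "R' \<noteq> {}" for R'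
  proof -
    obtain w where "w \<in> R'" using R' by blast
    moreover obtain z where "w @ z \<in> R" using * by blast
    ultimately show ?thesis using R' unfolding right_ideal_def by blast
  qed
  ultimately show ?thesis by (auto simp: essential_def)
qed

text \<open>If all generators have length at most \<open>N\<close>, a word of length at least
  \<open>N\<close> extends into \<open>R\<close>, hence is comparable with a generator, which must
  be its prefix. Conversely, if all words of length at least \<open>N\<close> lie in
  \<open>R\<close>, the members of length at most \<open>N\<close> generate \<open>R\<close>, and
  they are finitely many because the alphabet is finite.\<close>

lemma essential_fin_gen_iff:
  fixes R :: "'a::finite list set"
  shows "essential R \<and> fin_gen R \<longleftrightarrow> right_ideal R \<and> (\<forall>\<^sub>F w in long_words. w \<in> R)"
proof safe
  assume "essential R" "fin_gen R"
  then show "right_ideal R" by (simp add: essential_def)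
  obtain P where P: "finite P" "R = ideal_gen P" using \<open>fin_gen R\<close> by (auto simp: fin_gen_def)
  obtain N where N: "\<And>p. p \<in> P \<Longrightarrow> length p \<le> N"
    using P(1) by (meson finite_nat_set_iff_bounded_le finite_imageI imageI)
  have "w \<in> R" if "N \<le> length w" for w
  proof -
    obtain z where "w @ z \<in> R" using \<open>essential R\<close> by (auto simp: essential_iff)
    then obtain p u where "p \<in> P" "w @ z = p @ u" by (auto simp: P ideal_gen_def)
    then have "prefix p w" using N[of p] that by (metis prefixI prefix_length_prefix le_trans)
    then show ?thesis using \<open>p \<in> P\<close> by (auto simp: P ideal_gen_def elim: prefixE)
  qed
  then show "\<forall>\<^sub>F w in long_words. w \<in> R" by (auto simp: eventually_long_words)
next
  assume R: "right_ideal R" "\<forall>\<^sub>F w in long_words. w \<in> R"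
  show "essential R"
    using R eventually_long_wordsE[OF eventually_append[OF R(2)]] by (metis essential_iff)
  obtain N where N: "\<And>w. N \<le> length w \<Longrightarrow> w \<in> R" using R(2) by (auto simp: eventually_long_words)
  have "w \<in> ideal_gen {w \<in> R. length w \<le> N}" if "w \<in> R" for w
  proof (cases "length w \<le> N")
    case True
    then show ?thesis using that by (force simp: ideal_gen_def)
  next
    case False
    then have "w = take N w @ drop N w" "take N w \<in> R" "length (take N w) \<le> N" by (auto intro: N)
    then show ?thesis unfolding ideal_gen_def by blast
  qed
  then have "R = ideal_gen {w \<in> R. length w \<le> N}"
    using R(1) by (auto simp: ideal_gen_def right_ideal_def)
  moreover have "finite {w \<in> R. length w \<le> N}"
    by (rule finite_subset[OF _ finite_lists_length_le[OF finite_UNIV, of N]]) auto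
  ultimately show "fin_gen R" unfolding fin_gen_def by blast
qed

text \<open>The implication form includes closure of the domain under right multiplication, so that
  domain and range are right ideals automatically.\<close>

definition equivariant :: "('a list \<rightharpoonup> 'a list) \<Rightarrow> bool" where
  "equivariant \<phi> \<longleftrightarrow> (\<forall>x y z. \<phi> x = Some y \<longrightarrow> \<phi> (x @ z) = Some (y @ z))"

lemma equivariantD: "equivariant \<phi> \<Longrightarrow> \<phi> x = Some y \<Longrightarrow> \<phi> (x @ z) = Some (y @ z)"
  by (auto simp: equivariant_def)

lemma equivariant_right_ideal:
  "equivariant \<phi> \<Longrightarrow> right_ideal (dom \<phi>)" "equivariant \<phi> \<Longrightarrow> right_ideal (ran \<phi>)"
  by (auto simp: equivariant_def right_ideal_def ran_def)

lemma ran_eq_image_the: "ran \<phi> = (\<lambda>x. the (\<phi> x)) ` dom \<phi>"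
  by (force simp: ran_def)

text \<open>Both ideals are determined by the partial map, which allows the later arguments to speak
  of the map alone.\<close>

lemma ideal_iso_iff:
  "ideal_iso \<phi> R1 R2 \<longleftrightarrow> R1 = dom \<phi> \<and> R2 = ran \<phi> \<and> equivariant \<phi> \<and> inj_on \<phi> (dom \<phi>)"
proof -
  have inj: "inj_on (\<lambda>x. the (\<phi> x)) (dom \<phi>) \<longleftrightarrow> inj_on \<phi> (dom \<phi>)"
    unfolding inj_on_def by (metis domIff option.expand)
  have "equivariant \<phi> \<longleftrightarrow>
    right_ideal (dom \<phi>) \<and> (\<forall>r\<in>dom \<phi>. \<forall>z. the (\<phi> (r @ z)) = the (\<phi> r) @ z)"
    unfolding equivariant_def right_ideal_def by (auto simp: dom_def) (metis option.sel)+
  then show ?thesis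
    using equivariant_right_ideal[of \<phi>] by (auto simp: ideal_iso_def bij_betw_def inj ran_eq_image_the)
qed

lemma fg_essential_iso_iff:
  fixes \<phi> :: "'a::finite list \<rightharpoonup> 'a list"
  shows "fg_essential_iso \<phi> \<longleftrightarrow> equivariant \<phi> \<and> inj_on \<phi> (dom \<phi>) \<and>
    (\<forall>\<^sub>F w in long_words. w \<in> dom \<phi>) \<and> (\<forall>\<^sub>F w in long_words. w \<in> ran \<phi>)"
  unfolding fg_essential_iso_def ideal_iso_iff
  using essential_fin_gen_iff equivariant_right_ideal by blast

lemma fg_essential_isoD:
  fixes \<phi> :: "'a::finite list \<rightharpoonup> 'a list"
  assumes "fg_essential_iso \<phi>"
  shows "equivariant \<phi>" "inj_on \<phi> (dom \<phi>)"
    "\<forall>\<^sub>F w in long_words. w \<in> dom \<phi>" "\<forall>\<^sub>F w in long_words. w \<in> ran \<phi>"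
  using assms by (auto simp: fg_essential_iso_iff)

lemma fg_essential_iso_inj:
  fixes \<phi> :: "'a::finite list \<rightharpoonup> 'a list"
  shows "fg_essential_iso \<phi> \<Longrightarrow> \<phi> x = Some y \<Longrightarrow> \<phi> x' = Some y \<Longrightarrow> x = x'"
  by (metis domI fg_essential_isoD(2) inj_onD)

text \<open>If all words of length \<open>N\<close> are in the domain, only the first
  \<open>N\<close> letters of a long word are rewritten and the rest is copied. So long words have
  long images, which is what makes eventual statements compose.\<close>

lemma fg_essential_iso_filterlim:
  fixes \<phi> :: "'a::finite list \<rightharpoonup> 'a list"
  assumes "fg_essential_iso \<phi>"
  shows "filterlim (\<lambda>w. the (\<phi> w)) long_words long_words"
  unfolding filterlim_iff eventually_long_words
proof safe
  fix P :: "'a list \<Rightarrow> bool" and M assume M: "\<forall>w. M \<le> length w \<longrightarrow> P w"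
  obtain N where N: "\<And>w. N \<le> length w \<Longrightarrow> w \<in> dom \<phi>"
    using fg_essential_isoD(3)[OF assms] by (auto simp: eventually_long_words)
  have "P (the (\<phi> w))" if w: "N + M \<le> length w" for w
  proof -
    have "take N w \<in> dom \<phi>" using w by (intro N) auto
    then obtain y where "\<phi> (take N w) = Some y" by blast
    then have "\<phi> w = Some (y @ drop N w)"
      using equivariantD[OF fg_essential_isoD(1)[OF assms], of "take N w" y "drop N w"] by simp
    then show ?thesis using w M by simp
  qed
  then show "\<exists>N. \<forall>w. N \<le> length w \<longrightarrow> P (the (\<phi> w))" by blast
qed

definition inverse_map :: "('a \<rightharpoonup> 'b) \<Rightarrow> 'b \<rightharpoonup> 'a" where
  "inverse_map \<phi> y = (if y \<in> ran \<phi> then Some (SOME x. \<phi> x = Some y) else None)"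

lemma inverse_map_eq_Some_iff:
  assumes "inj_on \<phi> (dom \<phi>)"
  shows "inverse_map \<phi> y = Some x \<longleftrightarrow> \<phi> x = Some y"
proof
  assume "inverse_map \<phi> y = Some x"
  then have "\<exists>x. \<phi> x = Some y" "x = (SOME x. \<phi> x = Some y)"
    by (auto simp: inverse_map_def ran_def split: if_splits)
  then show "\<phi> x = Some y" using someI_ex[of "\<lambda>x. \<phi> x = Some y"] by simp
next
  assume x: "\<phi> x = Some y"
  then have "(SOME x. \<phi> x = Some y) = x"
    using assms by (intro some_equality) (metis domI inj_onD)+
  then show "inverse_map \<phi> y = Some x" using x by (auto simp: inverse_map_def ran_def)
qed

lemma fg_essential_iso_inverse_map:
  fixes \<phi> :: "'a::finite list \<rightharpoonup> 'a list"
  assumes "fg_essential_iso \<phi>"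
  shows "fg_essential_iso (inverse_map \<phi>)"
proof -
  note D = fg_essential_isoD[OF assms] and inv = inverse_map_eq_Some_iff[OF fg_essential_isoD(2)[OF assms]]
  have "dom (inverse_map \<phi>) = ran \<phi>" by (auto simp: inverse_map_def split: if_splits)
  moreover have "ran (inverse_map \<phi>) = dom \<phi>" by (auto simp: ran_def inv)
  moreover have "inj_on (inverse_map \<phi>) (dom (inverse_map \<phi>))"
    by (rule inj_onI) (metis domD inv option.inject)
  moreover have "equivariant (inverse_map \<phi>)" using D(1) by (auto simp: equivariant_def inv)
  ultimately show ?thesis using D by (simp add: fg_essential_iso_iff)
qed

lemma fg_essential_iso_Some: "fg_essential_iso (Some :: 'a::finite list \<rightharpoonup> 'a list)"
proof -
  have "ran (Some :: 'a list \<rightharpoonup> 'a list) = UNIV" by (auto simp: ran_def)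
  then show ?thesis by (simp add: fg_essential_iso_iff equivariant_def inj_on_def dom_def)
qed

lemma fg_essential_iso_comp:
  fixes \<phi> \<psi> :: "'a::finite list \<rightharpoonup> 'a list"
  assumes "fg_essential_iso \<phi>" "fg_essential_iso \<psi>"
  shows "fg_essential_iso (\<phi> \<circ>\<^sub>m \<psi>)"
proof -
  note D = fg_essential_isoD[OF assms(1)] and E = fg_essential_isoD[OF assms(2)]
  have dom_comp: "\<forall>\<^sub>F w in long_words. w \<in> dom (\<phi>' \<circ>\<^sub>m \<psi>')"
    if "fg_essential_iso \<phi>'" "fg_essential_iso \<psi>'" for \<phi>' \<psi>' :: "'a list \<rightharpoonup> 'a list"
    using fg_essential_isoD(3)[OF that(2)]
      eventually_compose_filterlim[OF fg_essential_isoD(3)[OF that(1)] fg_essential_iso_filterlim[OF that(2)]]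
    by eventually_elim (auto simp: map_comp_def)
  have inj: "inj_on (\<phi> \<circ>\<^sub>m \<psi>) (dom (\<phi> \<circ>\<^sub>m \<psi>))"
  proof (rule inj_onI)
    fix x y assume "x \<in> dom (\<phi> \<circ>\<^sub>m \<psi>)" "y \<in> dom (\<phi> \<circ>\<^sub>m \<psi>)" "(\<phi> \<circ>\<^sub>m \<psi>) x = (\<phi> \<circ>\<^sub>m \<psi>) y"
    then obtain u v z where "\<psi> x = Some u" "\<psi> y = Some v" "\<phi> u = Some z" "\<phi> v = Some z"
      by (auto simp: map_comp_def split: option.splits)
    then show "x = y" using fg_essential_iso_inj assms by metis
  qed
  have "equivariant (\<phi> \<circ>\<^sub>m \<psi>)"
    using D(1) E(1) by (auto simp: equivariant_def map_comp_def split: option.splits)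
  \<comment> \<open>The range of the composite is reached through the domain of the reversed
    composite of inverses, so that one argument, \<open>dom_comp\<close>, serves for domain and
    range.\<close>
  moreover have "dom (inverse_map \<psi> \<circ>\<^sub>m inverse_map \<phi>) \<subseteq> ran (\<phi> \<circ>\<^sub>m \<psi>)"
  proof
    fix w assume "w \<in> dom (inverse_map \<psi> \<circ>\<^sub>m inverse_map \<phi>)"
    then obtain u v where "inverse_map \<phi> w = Some u" "inverse_map \<psi> u = Some v"
      by (auto simp: map_comp_def split: option.splits)
    then have "(\<phi> \<circ>\<^sub>m \<psi>) v = Some w"
      by (simp add: inverse_map_eq_Some_iff[OF D(2)] inverse_map_eq_Some_iff[OF E(2)])
    then show "w \<in> ran (\<phi> \<circ>\<^sub>m \<psi>)" by (auto simp: ran_def)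
  qed
  then have "\<forall>\<^sub>F w in long_words. w \<in> ran (\<phi> \<circ>\<^sub>m \<psi>)"
    using dom_comp[OF fg_essential_iso_inverse_map[OF assms(2)] fg_essential_iso_inverse_map[OF assms(1)]]
    by (rule eventually_in_mono)
  ultimately show ?thesis using inj dom_comp[OF assms] by (simp add: fg_essential_iso_iff)
qed

section \<open>Maximal extensions\<close>

lemma fg_essential_iso_map_le_unique:
  fixes \<phi> \<psi> :: "'a::finite list \<rightharpoonup> 'a list"
  assumes "fg_essential_iso \<phi>" "equivariant \<psi>" "\<phi> \<subseteq>\<^sub>m \<psi>" "\<psi> x = Some y"
  shows "\<forall>\<^sub>F z in long_words. \<phi> (x @ z) = Some (y @ z)"
  using eventually_append[OF fg_essential_isoD(3)[OF assms(1)], of x]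
  by eventually_elim (metis assms(2-4) equivariantD map_le_def)

text \<open>
  The maximal extension in explicit form: it is defined at \<open>x\<close> iff \<open>\<phi>\<close> acts on all long words
  with prefix \<open>x\<close> by replacing this prefix.
\<close>

definition germ_ext :: "('a list \<rightharpoonup> 'a list) \<Rightarrow> 'a list \<rightharpoonup> 'a list" where
  "germ_ext \<phi> x = (if \<exists>y. \<forall>\<^sub>F z in long_words. \<phi> (x @ z) = Some (y @ z)
     then Some (SOME y. \<forall>\<^sub>F z in long_words. \<phi> (x @ z) = Some (y @ z)) else None)"

text \<open>The value is unique by right cancellation: two candidates satisfy
  \<open>y @ z = y' @ z\<close> for some long \<open>z\<close>, since \<open>long_words\<close> is a
  proper filter.\<close>

lemma germ_ext_eq_Some_iff:
  "germ_ext \<phi> x = Some y \<longleftrightarrow> (\<forall>\<^sub>F z in long_words. \<phi> (x @ z) = Some (y @ z))" (is "_ \<longleftrightarrow> ?P y")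
proof -
  have uniq: "y = y'" if "?P y" "?P y'" for y y'
  proof -
    have "\<forall>\<^sub>F z in long_words. y @ z = y' @ z" using that by eventually_elim simp
    then show ?thesis by (rule eventually_long_wordsE) simp
  qed
  then have "?P y \<Longrightarrow> (SOME y. ?P y) = y" by (intro some_equality)
  then show ?thesis using someI_ex[of ?P] by (auto simp: germ_ext_def)
qed

lemma map_le_germ_ext: "equivariant \<phi> \<Longrightarrow> \<phi> \<subseteq>\<^sub>m germ_ext \<phi>"
  unfolding map_le_def using equivariantD germ_ext_eq_Some_iff
  by (metis (mono_tags, lifting) always_eventually domD)

lemma fg_essential_iso_germ_ext:
  fixes \<phi> :: "'a::finite list \<rightharpoonup> 'a list"
  assumes "fg_essential_iso \<phi>"
  shows "fg_essential_iso (germ_ext \<phi>)"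
proof -
  note D = fg_essential_isoD[OF assms]
  have le: "\<phi> \<subseteq>\<^sub>m germ_ext \<phi>" using D(1) by (rule map_le_germ_ext)
  have "equivariant (germ_ext \<phi>)"
    unfolding equivariant_def germ_ext_eq_Some_iff using eventually_append by fastforce
  moreover have "inj_on (germ_ext \<phi>) (dom (germ_ext \<phi>))"
  proof (rule inj_onI)
    fix x x' assume "x \<in> dom (germ_ext \<phi>)" "germ_ext \<phi> x = germ_ext \<phi> x'"
    then obtain y where y: "germ_ext \<phi> x = Some y" "germ_ext \<phi> x' = Some y" by (metis domD)
    then have "\<forall>\<^sub>F z in long_words. \<phi> (x @ z) = Some (y @ z)"
      "\<forall>\<^sub>F z in long_words. \<phi> (x' @ z) = Some (y @ z)" by (simp_all add: germ_ext_eq_Some_iff)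
    then have "\<forall>\<^sub>F z in long_words. x @ z = x' @ z"
      by eventually_elim (rule fg_essential_iso_inj[OF assms])
    then show "x = x'" by (rule eventually_long_wordsE) simp
  qed
  moreover have "dom \<phi> \<subseteq> dom (germ_ext \<phi>)" "ran \<phi> \<subseteq> ran (germ_ext \<phi>)"
    using le by (auto simp: map_le_def ran_def dom_def) metis+
  ultimately show ?thesis
    using eventually_in_mono[OF _ D(3)] eventually_in_mono[OF _ D(4)] by (simp add: fg_essential_iso_iff)
qed

lemma fg_imp_essential_iso: "fg_essential_iso \<phi> \<Longrightarrow> essential_iso \<phi>"
  by (auto simp: fg_essential_iso_def essential_iso_def)

text \<open>The competitors include isomorphisms of ideals that are not finitely generated, because
  \<open>maximal_iso\<close> quantifies over all of \<open>essential_iso\<close>. Equivariance of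
  the larger map and eventual definedness of the smaller one are enough.\<close>

lemma map_le_germ_extI:
  fixes \<phi> :: "'a::finite list \<rightharpoonup> 'a list"
  assumes "fg_essential_iso \<phi>" "essential_iso \<psi>" "\<phi> \<subseteq>\<^sub>m \<psi>"
  shows "\<psi> \<subseteq>\<^sub>m germ_ext \<phi>"
proof -
  have "equivariant \<psi>" using assms(2) by (auto simp: essential_iso_def ideal_iso_iff)
  then have "germ_ext \<phi> x = Some y" if "\<psi> x = Some y" for x y
    using fg_essential_iso_map_le_unique[OF assms(1) _ assms(3) that] by (simp add: germ_ext_eq_Some_iff)
  then show ?thesis by (force simp: map_le_def)
qed

lemma maximal_iso_germ_ext:
  fixes \<phi> :: "'a::finite list \<rightharpoonup> 'a list"
  assumes "fg_essential_iso \<phi>"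
  shows "maximal_iso (germ_ext \<phi>)"
  unfolding maximal_iso_def
  using map_le_germ_extI[OF assms] map_le_germ_ext[OF fg_essential_isoD(1)[OF assms]]
    fg_imp_essential_iso[OF fg_essential_iso_germ_ext[OF assms]]
  by (metis map_le_antisym map_le_trans)

text \<open>Supplies the existence and uniqueness behind the definite description in
  \<open>max_ext\<close>: \<open>germ_ext\<close> is the greatest extension, so any maximal one
  equals it.\<close>

lemma max_ext_eq_germ_ext:
  fixes \<phi> :: "'a::finite list \<rightharpoonup> 'a list"
  assumes "fg_essential_iso \<phi>"
  shows "max_ext \<phi> = germ_ext \<phi>"
  unfolding max_ext_def
proof (rule the_equality)
  show "maximal_iso (germ_ext \<phi>) \<and> \<phi> \<subseteq>\<^sub>m germ_ext \<phi>"
    using assms maximal_iso_germ_ext map_le_germ_ext fg_essential_isoD(1) by blast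
  show "\<psi> = germ_ext \<phi>" if "maximal_iso \<psi> \<and> \<phi> \<subseteq>\<^sub>m \<psi>" for \<psi>
    using that map_le_germ_extI[OF assms] fg_imp_essential_iso[OF fg_essential_iso_germ_ext[OF assms]]
    unfolding maximal_iso_def by metis
qed

lemma max_ext_eq_Some_iff:
  fixes \<phi> :: "'a::finite list \<rightharpoonup> 'a list"
  assumes "fg_essential_iso \<phi>"
  shows "max_ext \<phi> x = Some y \<longleftrightarrow> (\<forall>\<^sub>F z in long_words. \<phi> (x @ z) = Some (y @ z))"
  using assms by (simp add: max_ext_eq_germ_ext germ_ext_eq_Some_iff)

lemma map_le_max_ext:
  fixes \<phi> :: "'a::finite list \<rightharpoonup> 'a list"
  shows "fg_essential_iso \<phi> \<Longrightarrow> \<phi> \<subseteq>\<^sub>m max_ext \<phi>"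
  by (simp add: max_ext_eq_germ_ext map_le_germ_ext fg_essential_isoD)

lemma max_ext_cong:
  fixes \<phi> \<psi> :: "'a::finite list \<rightharpoonup> 'a list"
  assumes "fg_essential_iso \<phi>" "fg_essential_iso \<psi>" "\<forall>\<^sub>F w in long_words. \<phi> w = \<psi> w"
  shows "max_ext \<phi> = max_ext \<psi>"
proof -
  have "max_ext \<phi> x = Some y \<longleftrightarrow> max_ext \<psi> x = Some y" for x y
  proof -
    have "\<forall>\<^sub>F z in long_words. (\<phi> (x @ z) = Some (y @ z)) = (\<psi> (x @ z) = Some (y @ z))"
      using eventually_append[OF assms(3), of x] by eventually_elim simp
    then show ?thesis
      unfolding max_ext_eq_Some_iff[OF assms(1)] max_ext_eq_Some_iff[OF assms(2)] 
      by (rule eventually_subst)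
  qed
  then show ?thesis by (metis ext not_Some_eq)
qed

lemma max_ext_eventually_eq:
  fixes \<phi> :: "'a::finite list \<rightharpoonup> 'a list"
  assumes "fg_essential_iso \<phi>"
  shows "\<forall>\<^sub>F w in long_words. max_ext \<phi> w = \<phi> w"
  using fg_essential_isoD(3)[OF assms]
  by (rule eventually_mono) (metis map_le_def map_le_max_ext[OF assms])

section \<open>The group laws\<close>

lemma carrier_thompson_G: "carrier thompson_G = {\<phi>. fg_essential_iso \<phi> \<and> maximal_iso \<phi>}"
  and mult_thompson_G: "\<phi> \<otimes>\<^bsub>thompson_G\<^esub> \<psi> = max_ext (\<phi> \<circ>\<^sub>m \<psi>)"
  and one_thompson_G: "\<one>\<^bsub>thompson_G\<^esub> = Some"
  by (simp_all add: thompson_G_def)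

lemma carrier_thompson_G_fg: "\<phi> \<in> carrier thompson_G \<Longrightarrow> fg_essential_iso \<phi>"
  by (simp add: carrier_thompson_G)

lemma max_ext_in_carrier:
  fixes \<phi> :: "'a::finite list \<rightharpoonup> 'a list"
  shows "fg_essential_iso \<phi> \<Longrightarrow> max_ext \<phi> \<in> carrier thompson_G"
  by (simp add: carrier_thompson_G max_ext_eq_germ_ext maximal_iso_germ_ext fg_essential_iso_germ_ext)

lemma max_ext_carrier:
  fixes \<phi> :: "'a::finite list \<rightharpoonup> 'a list"
  assumes "\<phi> \<in> carrier thompson_G"
  shows "max_ext \<phi> = \<phi>"
  using assms map_le_max_ext[of \<phi>] max_ext_in_carrier[of \<phi>] fg_imp_essential_iso[of "max_ext \<phi>"]
  by (auto simp: carrier_thompson_G maximal_iso_def)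

text \<open>The usual way to evaluate a product: it equals any group element that extends the bare
  composite.\<close>

lemma max_ext_map_le:
  fixes \<phi> \<psi> :: "'a::finite list \<rightharpoonup> 'a list"
  assumes "fg_essential_iso \<phi>" "\<psi> \<in> carrier thompson_G" "\<phi> \<subseteq>\<^sub>m \<psi>"
  shows "max_ext \<phi> = \<psi>"
proof -
  have "\<forall>\<^sub>F w in long_words. \<phi> w = \<psi> w"
    using fg_essential_isoD(3)[OF assms(1)] by (rule eventually_mono) (metis map_le_def assms(3))
  then have "max_ext \<phi> = max_ext \<psi>"
    by (intro max_ext_cong assms carrier_thompson_G_fg)
  then show ?thesis by (simp add: max_ext_carrier assms(2))
qed

text \<open>A total map has no proper extension, so the identity is its own maximal
  extension.\<close>

lemma Some_in_carrier: "(Some :: 'a::finite list \<rightharpoonup> 'a list) \<in> carrier thompson_G"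
proof -
  have "Some \<subseteq>\<^sub>m max_ext (Some :: 'a list \<rightharpoonup> 'a list)"
    by (intro map_le_max_ext fg_essential_iso_Some)
  then have "max_ext (Some :: 'a list \<rightharpoonup> 'a list) = Some" by (force simp: map_le_def)
  then show ?thesis using max_ext_in_carrier[OF fg_essential_iso_Some] by metis
qed

lemma eventually_eq_comp:
  fixes \<phi> \<psi> :: "'a::finite list \<rightharpoonup> 'a list"
  assumes "fg_essential_iso \<psi>'" "\<forall>\<^sub>F w in long_words. \<phi> w = \<phi>' w" "\<forall>\<^sub>F w in long_words. \<psi> w = \<psi>' w"
  shows "\<forall>\<^sub>F w in long_words. (\<phi> \<circ>\<^sub>m \<psi>) w = (\<phi>' \<circ>\<^sub>m \<psi>') w"
  using eventually_compose_filterlim[OF assms(2) fg_essential_iso_filterlim[OF assms(1)]] assms(3)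
    fg_essential_isoD(3)[OF assms(1)]
  by eventually_elim (auto simp: map_comp_def)

text \<open>Maximal extension may be postponed to the end of a calculation. Associativity in the
  group thereby reduces to that of composition of partial maps.\<close>

lemma max_ext_mult:
  fixes \<phi> \<psi> :: "'a::finite list \<rightharpoonup> 'a list"
  assumes "fg_essential_iso \<phi>" "fg_essential_iso \<psi>"
  shows "max_ext \<phi> \<otimes>\<^bsub>thompson_G\<^esub> max_ext \<psi> = max_ext (\<phi> \<circ>\<^sub>m \<psi>)"
  unfolding mult_thompson_G
  by (intro max_ext_cong eventually_eq_comp fg_essential_iso_comp assms max_ext_eventually_eq
      carrier_thompson_G_fg max_ext_in_carrier)

lemma max_ext_inverse_map_mult:
  fixes \<phi> :: "'a::finite list \<rightharpoonup> 'a list"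
  assumes "\<phi> \<in> carrier thompson_G"
  shows "max_ext (inverse_map \<phi>) \<in> carrier thompson_G"
    and "max_ext (inverse_map \<phi>) \<otimes>\<^bsub>thompson_G\<^esub> \<phi> = \<one>\<^bsub>thompson_G\<^esub>"
proof -
  note fg = carrier_thompson_G_fg[OF assms]
  have inv: "fg_essential_iso (inverse_map \<phi>)" using fg by (rule fg_essential_iso_inverse_map)
  then show "max_ext (inverse_map \<phi>) \<in> carrier thompson_G" by (rule max_ext_in_carrier)
  have "max_ext (inverse_map \<phi>) \<otimes>\<^bsub>thompson_G\<^esub> max_ext \<phi> = max_ext (inverse_map \<phi> \<circ>\<^sub>m \<phi>)"
    by (intro max_ext_mult inv fg)
  also have "\<dots> = Some"
    \<comment> \<open>The composite is the identity restricted to the domain of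
      \<open>\<phi>\<close>, hence a restriction of \<open>Some\<close>.\<close>
    by (intro max_ext_map_le fg_essential_iso_comp inv fg Some_in_carrier)
      (auto simp: map_le_def map_comp_def inverse_map_eq_Some_iff[OF fg_essential_isoD(2)[OF fg]]
        split: option.splits)
  finally show "max_ext (inverse_map \<phi>) \<otimes>\<^bsub>thompson_G\<^esub> \<phi> = \<one>\<^bsub>thompson_G\<^esub>"
    by (simp add: max_ext_carrier assms one_thompson_G)
qed

lemma group_thompson_G: "group (thompson_G :: ('a::finite list \<rightharpoonup> 'a list) monoid)"
proof (rule groupI)
  fix \<phi> \<psi> \<chi> :: "'a list \<rightharpoonup> 'a list"
  assume \<phi>: "\<phi> \<in> carrier thompson_G"
  then have fg\<phi>: "fg_essential_iso \<phi>" by (rule carrier_thompson_G_fg)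
  show "\<one>\<^bsub>thompson_G\<^esub> \<otimes>\<^bsub>thompson_G\<^esub> \<phi> = \<phi>"
  proof -
    have "Some \<circ>\<^sub>m \<phi> = \<phi>" by (auto simp: map_comp_def split: option.splits)
    then show ?thesis by (simp add: mult_thompson_G one_thompson_G max_ext_carrier \<phi>)
  qed
  show "\<exists>\<psi>\<in>carrier thompson_G. \<psi> \<otimes>\<^bsub>thompson_G\<^esub> \<phi> = \<one>\<^bsub>thompson_G\<^esub>"
    using max_ext_inverse_map_mult[OF \<phi>] by blast
  assume \<psi>: "\<psi> \<in> carrier thompson_G"
  then have fg\<psi>: "fg_essential_iso \<psi>" by (rule carrier_thompson_G_fg)
  show "\<phi> \<otimes>\<^bsub>thompson_G\<^esub> \<psi> \<in> carrier thompson_G"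
    unfolding mult_thompson_G by (intro max_ext_in_carrier fg_essential_iso_comp fg\<phi> fg\<psi>)
  assume \<chi>: "\<chi> \<in> carrier thompson_G"
  then have fg\<chi>: "fg_essential_iso \<chi>" by (rule carrier_thompson_G_fg)
  have assoc: "\<phi> \<circ>\<^sub>m \<psi> \<circ>\<^sub>m \<chi> = \<phi> \<circ>\<^sub>m (\<psi> \<circ>\<^sub>m \<chi>)"
    by (rule ext) (simp add: map_comp_def split: option.splits)
  have "max_ext (\<phi> \<circ>\<^sub>m \<psi>) \<otimes>\<^bsub>thompson_G\<^esub> max_ext \<chi> = max_ext \<phi> \<otimes>\<^bsub>thompson_G\<^esub> max_ext (\<psi> \<circ>\<^sub>m \<chi>)"
    by (simp add: max_ext_mult fg_essential_iso_comp fg\<phi> fg\<psi> fg\<chi> assoc)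
  then show "\<phi> \<otimes>\<^bsub>thompson_G\<^esub> \<psi> \<otimes>\<^bsub>thompson_G\<^esub> \<chi> = \<phi> \<otimes>\<^bsub>thompson_G\<^esub> (\<psi> \<otimes>\<^bsub>thompson_G\<^esub> \<chi>)"
    by (simp add: mult_thompson_G max_ext_carrier \<phi> \<chi>)
qed (simp add: one_thompson_G Some_in_carrier)

text \<open>Only this direction holds: through maximal extension the product may also be defined at
  words where the composite is not.\<close>

lemma thompson_G_mult_eq_Some:
  fixes \<phi> \<psi> :: "'a::finite list \<rightharpoonup> 'a list"
  assumes "\<phi> \<in> carrier thompson_G" "\<psi> \<in> carrier thompson_G" "\<psi> x = Some y" "\<phi> y = Some z"
  shows "(\<phi> \<otimes>\<^bsub>thompson_G\<^esub> \<psi>) x = Some z"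
proof -
  have "(\<phi> \<circ>\<^sub>m \<psi>) x = Some z" using assms by simp
  moreover have "fg_essential_iso (\<phi> \<circ>\<^sub>m \<psi>)"
    using assms by (intro fg_essential_iso_comp carrier_thompson_G_fg)
  ultimately show ?thesis
    unfolding mult_thompson_G by (metis map_le_max_ext domI map_le_def)
qed

lemma thompson_G_inv:
  fixes \<phi> :: "'a::finite list \<rightharpoonup> 'a list"
  assumes "\<phi> \<in> carrier thompson_G"
  shows "inv\<^bsub>thompson_G\<^esub> \<phi> = max_ext (inverse_map \<phi>)"
proof -
  interpret group "thompson_G :: ('a list \<rightharpoonup> 'a list) monoid" by (rule group_thompson_G)
  show ?thesis using max_ext_inverse_map_mult[OF assms] assms by (intro inv_equality)
qed

text \<open>The forward implication is the backward one applied to the inverse element. In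
  particular the inverse acquires no new domain from its maximal extension.\<close>

lemma thompson_G_inv_eq_Some_iff:
  fixes \<phi> :: "'a::finite list \<rightharpoonup> 'a list"
  assumes "\<phi> \<in> carrier thompson_G"
  shows "(inv\<^bsub>thompson_G\<^esub> \<phi>) y = Some x \<longleftrightarrow> \<phi> x = Some y"
proof -
  interpret group "thompson_G :: ('a list \<rightharpoonup> 'a list) monoid" by (rule group_thompson_G)
  have *: "(inv\<^bsub>thompson_G\<^esub> \<psi>) y = Some x" 
    if \<psi>: "\<psi> \<in> carrier thompson_G" "\<psi> x = Some y" for \<psi> :: "'a list \<rightharpoonup> 'a list" and x y
  proof -
    note fg = carrier_thompson_G_fg[OF \<psi>(1)]
    have "inverse_map \<psi> y = Some x"
      using \<psi>(2) inverse_map_eq_Some_iff[OF fg_essential_isoD(2)[OF fg]] by blast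
    then show ?thesis
      using map_le_max_ext[OF fg_essential_iso_inverse_map[OF fg]]
      unfolding thompson_G_inv[OF \<psi>(1)] by (metis domI map_le_def)
  qed
  from *[of \<phi> x y] *[of "inv\<^bsub>thompson_G\<^esub> \<phi>" y x] show ?thesis using assms by auto
qed

section \<open>Finite maximal prefix codes\<close>

text \<open>Maximality means that every word is comparable with a member, since otherwise it could
  be added. For a word at least as long as all members this forces a member as its prefix.
  Conversely, a word of a larger code has a long extension covered by some member of
  \<open>Q\<close>, which is comparable with it and hence equal to it.\<close>

lemma maximal_prefix_code_iff:
  assumes "finite Q"
  shows "maximal_prefix_code Q \<longleftrightarrow> prefix_code Q \<and> (\<forall>\<^sub>F w in long_words. w \<in> ideal_gen Q)"
proof
  assume Q: "maximal_prefix_code Q"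
  obtain N where N: "\<And>q. q \<in> Q \<Longrightarrow> length q \<le> N"
    using assms by (meson finite_nat_set_iff_bounded_le finite_imageI imageI)
  have "w \<in> ideal_gen Q" if w: "N \<le> length w" for w
  proof -
    have "\<exists>q\<in>Q. prefix q w \<or> prefix w q"
    proof (rule ccontr)
      assume *: "\<not> (\<exists>q\<in>Q. prefix q w \<or> prefix w q)"
      then have "prefix_code (insert w Q)"
        using Q by (auto simp: maximal_prefix_code_def prefix_code_def)
      then have "w \<in> Q" using Q unfolding maximal_prefix_code_def by blast
      then show False using * by blast
    qed
    then obtain q where q: "q \<in> Q" "prefix q w \<or> prefix w q" by blast
    then have "prefix q w" using N[of q] w by (metis not_equal_is_parallel parallelD1 parallelD2 prefix_length_le le_antisym le_trans)
    then show ?thesis using q(1) by (auto simp: ideal_gen_def prefix_def)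
  qed
  then show "prefix_code Q \<and> (\<forall>\<^sub>F w in long_words. w \<in> ideal_gen Q)"
    using Q by (auto simp: eventually_long_words maximal_prefix_code_def)
next
  assume Q: "prefix_code Q \<and> (\<forall>\<^sub>F w in long_words. w \<in> ideal_gen Q)"
  have "w \<in> Q" if Q': "prefix_code Q'" "Q \<subseteq> Q'" "w \<in> Q'" for Q' w
  proof -
    obtain z where "w @ z \<in> ideal_gen Q"
      using eventually_long_wordsE[OF eventually_append[OF conjunct2[OF Q], of w]] by blast
    then obtain q u where q: "q \<in> Q" "w @ z = q @ u" by (auto simp: ideal_gen_def)
    then have "prefix w q \<or> prefix q w" by (metis prefixI prefix_same_cases)
    then show ?thesis using Q' q(1) unfolding prefix_code_def by blast
  qed
  then show "maximal_prefix_code Q" using Q unfolding maximal_prefix_code_def by blast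
qed

lemma maximal_prefix_codeD:
  assumes "finite Q" "maximal_prefix_code Q"
  shows "prefix_code Q" "\<forall>\<^sub>F w in long_words. w \<in> ideal_gen Q" "Q \<noteq> {}"
proof -
  show "prefix_code Q" and *: "\<forall>\<^sub>F w in long_words. w \<in> ideal_gen Q"
    using assms maximal_prefix_code_iff by auto
  show "Q \<noteq> {}" using eventually_long_wordsE[OF *] by (auto simp: ideal_gen_def)
qed

text \<open>For large \<open>n\<close> this code lies in the domain of a given isomorphism and
  contains extensions of any prescribed short words; \<open>thompson_T_eq\<close> uses it in this
  way.\<close>

lemma maximal_prefix_code_length: "maximal_prefix_code {w :: 'a::finite list. length w = n}"
proof -
  have "finite {w :: 'a list. length w = n}" using finite_lists_length_eq[OF finite_UNIV, of n] by simp
  moreover have "w \<in> ideal_gen {w. length w = n}" if "n \<le> length w" for w :: "'a list"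
    unfolding ideal_gen_def mem_Collect_eq
    by (intro exI[of _ "take n w"] exI[of _ "drop n w"]) (use that in auto)
  ultimately show ?thesis
    by (auto simp: maximal_prefix_code_iff prefix_code_def eventually_long_words prefix_def)
qed

lemma finite_code_power:
  fixes P :: "'a::finite list set"
  assumes "finite P"
  shows "finite (code_power P n)"
proof -
  have "code_power P n = (\<lambda>(p, w). p @ w) ` (P \<times> {w. set w \<subseteq> UNIV \<and> length w = n})"
    by (auto simp: code_power_def)
  moreover have "finite {w :: 'a list. set w \<subseteq> UNIV \<and> length w = n}"
    by (intro finite_lists_length_eq finite_UNIV)
  ultimately show ?thesis using assms by simp
qed

lemma maximal_prefix_code_code_power:
  fixes P :: "'a::finite list set"
  assumes "finite P" "maximal_prefix_code P"
  shows "maximal_prefix_code (code_power P n)"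
proof -
  note P = maximal_prefix_codeD[OF assms]
  have "x = y" if xy: "x \<in> code_power P n" "y \<in> code_power P n" "prefix x y" for x y
  proof -
    obtain p u q v where *: "x = p @ u" "p \<in> P" "length u = n" "y = q @ v" "q \<in> P" "length v = n"
      using xy by (auto simp: code_power_def)
    then have "prefix p q \<or> prefix q p"
      using xy(3) by (metis prefixI prefix_order.trans prefix_same_cases)
    then have "p = q" using P(1) * unfolding prefix_code_def by metis
    then show "x = y" using * xy(3) by (auto simp: prefix_def)
  qed
  moreover obtain N where N: "\<And>w. N \<le> length w \<Longrightarrow> w \<in> ideal_gen P"
    using P(2) by (auto simp: eventually_long_words)
  have "w \<in> ideal_gen (code_power P n)" if w: "N + n \<le> length w" for w
  proof -
    obtain p z where pz: "take N w = p @ z" "p \<in> P"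
      using N[of "take N w"] w by (auto simp: ideal_gen_def)
    \<comment> \<open>The first \<open>N\<close> letters contain a member \<open>p\<close> of
      \<open>P\<close>, and the bound \<open>N + n\<close> leaves at least \<open>n\<close> letters
      behind \<open>p\<close>, of which the first \<open>n\<close> are joined to it.\<close>
    have "w = (p @ take n (z @ drop N w)) @ drop n (z @ drop N w)"
      using pz(1) by (metis append.assoc append_take_drop_id)
    moreover have "length (take n (z @ drop N w)) = n" using w by simp
    ultimately show ?thesis using pz(2) unfolding ideal_gen_def code_power_def by blast
  qed
  ultimately show ?thesis
    using finite_code_power[OF assms(1)]
    by (auto simp: maximal_prefix_code_iff prefix_code_def eventually_long_words)
qed

lemma code_power_Suc: "code_power P (Suc n) = {q @ [a] | q a. q \<in> code_power P n}"
proof -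
  have "\<exists>q a. p @ w = q @ [a] \<and> (\<exists>p w. q = p @ w \<and> p \<in> P \<and> length w = n)"
    if "p \<in> P" "length w = Suc n" for p w
    using that by (metis append.assoc length_Suc_conv_rev)
  then show ?thesis unfolding code_power_def by fastforce
qed

lemma eventually_code_power:
  assumes "\<forall>\<^sub>F w in long_words. w \<in> R" "P \<noteq> {}"
  shows "\<exists>n\<ge>1. code_power P n \<subseteq> R"
proof -
  obtain N where N: "\<And>w. N \<le> length w \<Longrightarrow> w \<in> R" using assms by (auto simp: eventually_long_words)
  \<comment> \<open>The exponent is \<open>Suc N\<close> rather than \<open>N\<close> to meet
    \<open>n \<ge> 1\<close>, the range of the unions.\<close>
  then have "code_power P (Suc N) \<subseteq> R" by (auto simp: code_power_def)
  then show ?thesis by (metis le_numeral_extra(4) not_less_eq_eq One_nat_def le_SucI nat_le_linear Suc_le_mono zero_le)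
qed

text \<open>Prefixes are preserved by equivariance. They are reflected by injectivity: if
  \<open>y' = x' @ z\<close>, then \<open>x @ z\<close> and \<open>y\<close> have the same
  image.\<close>

lemma fg_essential_iso_prefix_iff:
  fixes \<phi> :: "'a::finite list \<rightharpoonup> 'a list"
  assumes "fg_essential_iso \<phi>" "\<phi> x = Some x'" "\<phi> y = Some y'"
  shows "prefix x' y' \<longleftrightarrow> prefix x y"
  using assms(2,3) equivariantD[OF fg_essential_isoD(1)[OF assms(1)]] fg_essential_iso_inj[OF assms(1)]
  unfolding prefix_def by (metis option.inject)

text \<open>Prefix relations transfer both ways, and so does covering of long words, because the map
  and its inverse both send long words to long words. The backward direction makes the inverse image
  of a code a code; the equivalence is also what the definition of \<open>T\<close> calls
  for.\<close>

lemma maximal_prefix_code_image_iff: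
  fixes \<phi> :: "'a::finite list \<rightharpoonup> 'a list"
  assumes \<phi>: "fg_essential_iso \<phi>" and Q: "Q \<subseteq> dom \<phi>" "finite Q"
  shows "maximal_prefix_code ((\<lambda>x. the (\<phi> x)) ` Q) \<longleftrightarrow> maximal_prefix_code Q"
proof -
  have app: "\<phi> q = Some (the (\<phi> q))" if "q \<in> Q" for q using that Q by auto
  have eq: "the (\<phi> x) = the (\<phi> y) \<longleftrightarrow> x = y" if "x \<in> Q" "y \<in> Q" for x y
    using app[OF that(1)] app[OF that(2)] fg_essential_iso_inj[OF \<phi>] by metis
  have prefix: "prefix_code ((\<lambda>x. the (\<phi> x)) ` Q) \<longleftrightarrow> prefix_code Q"
    using fg_essential_iso_prefix_iff[OF \<phi> app app] by (simp add: prefix_code_def eq)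
  have gen: "y \<in> ideal_gen ((\<lambda>x. the (\<phi> x)) ` Q) \<longleftrightarrow> x \<in> ideal_gen Q" if "\<phi> x = Some y" for x y
  proof
    assume "y \<in> ideal_gen ((\<lambda>x. the (\<phi> x)) ` Q)"
    then obtain q z where q: "q \<in> Q" "y = the (\<phi> q) @ z" by (auto simp: ideal_gen_def)
    then have "\<phi> (q @ z) = Some y" using equivariantD[OF fg_essential_isoD(1)[OF \<phi>] app] by simp
    then have "x = q @ z" using fg_essential_iso_inj[OF \<phi> that] by simp
    then show "x \<in> ideal_gen Q" using q(1) by (auto simp: ideal_gen_def)
  next
    assume "x \<in> ideal_gen Q"
    then obtain q z where q: "q \<in> Q" "x = q @ z" by (auto simp: ideal_gen_def)
    then have "y = the (\<phi> q) @ z"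
      using equivariantD[OF fg_essential_isoD(1)[OF \<phi>] app, of q z] that by simp
    then show "y \<in> ideal_gen ((\<lambda>x. the (\<phi> x)) ` Q)" using q(1) by (auto simp: ideal_gen_def)
  qed
  have "(\<forall>\<^sub>F y in long_words. y \<in> ideal_gen ((\<lambda>x. the (\<phi> x)) ` Q)) \<longleftrightarrow>
    (\<forall>\<^sub>F x in long_words. x \<in> ideal_gen Q)" (is "?L \<longleftrightarrow> ?R")
  proof
    assume ?L
    then show ?R
      using eventually_compose_filterlim[OF \<open>?L\<close> fg_essential_iso_filterlim[OF \<phi>]] fg_essential_isoD(3)[OF \<phi>]
      by eventually_elim (auto simp: gen)
  next
    assume ?R
    note inv = inverse_map_eq_Some_iff[OF fg_essential_isoD(2)[OF \<phi>]]
    show ?L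
      using fg_essential_isoD(3)[OF fg_essential_iso_inverse_map[OF \<phi>]]
        eventually_compose_filterlim[OF \<open>?R\<close> fg_essential_iso_filterlim[OF fg_essential_iso_inverse_map[OF \<phi>]]]
      by eventually_elim (auto simp: inv gen)
  qed
  then show ?thesis using Q(2) prefix by (simp add: maximal_prefix_code_iff)
qed

section \<open>Maps and permutations of codes as group elements\<close>

lemma code_ext_append:
  assumes "prefix_code Q" "q \<in> Q"
  shows "code_ext Q f (q @ z) = Some (f q @ z)"
proof -
  have "(THE p. p \<in> Q \<and> prefix p (q @ z)) = q"
    using assms unfolding prefix_code_def
    by (intro the_equality) (auto, metis prefixI prefix_same_cases)
  then show ?thesis using assms(2) by (auto simp: code_ext_def ideal_gen_def Let_def)
qed

lemma dom_code_ext: "dom (code_ext Q f) = ideal_gen Q"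
  by (auto simp: code_ext_def Let_def split: if_splits)

lemma code_ext_eq_SomeE:
  assumes "prefix_code Q" "code_ext Q f x = Some y"
  obtains q z where "q \<in> Q" "x = q @ z" "y = f q @ z"
proof -
  have "x \<in> ideal_gen Q" using assms(2) dom_code_ext by blast
  then obtain q z where "q \<in> Q" "x = q @ z" by (auto simp: ideal_gen_def)
  then show thesis using assms code_ext_append that by fastforce
qed

lemma fg_essential_iso_code_ext:
  fixes Q :: "'a::finite list set"
  assumes Q: "finite Q" "maximal_prefix_code Q" and f: "inj_on f Q" "maximal_prefix_code (f ` Q)"
  shows "fg_essential_iso (code_ext Q f)"
proof -
  note cQ = maximal_prefix_codeD[OF Q] and cf = maximal_prefix_codeD[OF finite_imageI[OF Q(1)] f(2)]
  have "equivariant (code_ext Q f)"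
    unfolding equivariant_def
  proof (intro allI impI)
    fix x y z assume "code_ext Q f x = Some y"
    then obtain q u where "q \<in> Q" "x = q @ u" "y = f q @ u" by (rule code_ext_eq_SomeE[OF cQ(1)])
    then show "code_ext Q f (x @ z) = Some (y @ z)" using code_ext_append[OF cQ(1)] by simp
  qed
  moreover have "inj_on (code_ext Q f) (dom (code_ext Q f))"
  proof (rule inj_onI)
    fix x x' assume "x \<in> dom (code_ext Q f)" "code_ext Q f x = code_ext Q f x'"
    then obtain y where y: "code_ext Q f x = Some y" "code_ext Q f x' = Some y" by (metis domD)
    obtain q z where q: "q \<in> Q" "x = q @ z" "y = f q @ z" using y(1) by (rule code_ext_eq_SomeE[OF cQ(1)])
    obtain q' z' where q': "q' \<in> Q" "x' = q' @ z'" "y = f q' @ z'" using y(2) by (rule code_ext_eq_SomeE[OF cQ(1)])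
    have "prefix (f q) (f q') \<or> prefix (f q') (f q)"
      using q q' by (metis prefixI prefix_same_cases)
    then have "f q = f q'" using q q' cf(1) unfolding prefix_code_def by (metis imageI)
    then show "x = x'" using q q' f(1) by (auto dest: inj_onD)
  qed
  moreover have "ideal_gen (f ` Q) \<subseteq> ran (code_ext Q f)"
    using code_ext_append[OF cQ(1), of _ f] by (auto simp: ideal_gen_def ran_def)
  ultimately show ?thesis
    using cQ(2) eventually_in_mono[OF _ cf(2)] by (simp add: fg_essential_iso_iff dom_code_ext)
qed

lemma represented_in_carrier:
  fixes Q :: "'a::finite list set"
  assumes "finite Q" "maximal_prefix_code Q" "inj_on f Q" "maximal_prefix_code (f ` Q)"
  shows "represented Q f \<in> carrier thompson_G"
  unfolding represented_def by (intro max_ext_in_carrier fg_essential_iso_code_ext assms)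

lemma represented_eq_Some:
  fixes Q :: "'a::finite list set"
  assumes "finite Q" "maximal_prefix_code Q" "inj_on f Q" "maximal_prefix_code (f ` Q)" "q \<in> Q"
  shows "represented Q f q = Some (f q)"
  using code_ext_append[OF maximal_prefix_codeD(1)[OF assms(1,2)] assms(5), of f "[]"]
    map_le_max_ext[OF fg_essential_iso_code_ext[OF assms(1-4)]]
  unfolding represented_def map_le_def by (metis append_Nil2 domI)

text \<open>Injectivity of \<open>f\<close> on \<open>Q\<close> and the maximality of its image code
  are inherited from \<open>\<phi>\<close>. The extension of \<open>f\<close> is then a restriction
  of \<open>\<phi>\<close>, so both have the same maximal extension.\<close>

lemma represented_unique:
  fixes Q :: "'a::finite list set"
  assumes Q: "finite Q" "maximal_prefix_code Q" and \<phi>: "\<phi> \<in> carrier thompson_G"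
    and f: "\<And>q. q \<in> Q \<Longrightarrow> \<phi> q = Some (f q)"
  shows "represented Q f = \<phi>"
proof -
  note fg = carrier_thompson_G_fg[OF \<phi>]
  have "(\<lambda>x. the (\<phi> x)) ` Q = f ` Q" using f by force
  then have "maximal_prefix_code (f ` Q)"
    using maximal_prefix_code_image_iff[OF fg, of Q] Q f by auto
  moreover have "inj_on f Q" by (rule inj_onI) (metis f fg_essential_iso_inj[OF fg])
  ultimately have "fg_essential_iso (code_ext Q f)" using Q by (intro fg_essential_iso_code_ext)
  moreover have "code_ext Q f \<subseteq>\<^sub>m \<phi>"
    unfolding map_le_def
  proof
    fix x assume "x \<in> dom (code_ext Q f)"
    then obtain y where y: "code_ext Q f x = Some y" by blast
    then obtain q z where "q \<in> Q" "x = q @ z" "y = f q @ z"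
      by (rule code_ext_eq_SomeE[OF maximal_prefix_codeD(1)[OF Q]])
    then show "code_ext Q f x = \<phi> x" using y f equivariantD[OF fg_essential_isoD(1)[OF fg]] by simp
  qed
  ultimately show ?thesis unfolding represented_def using \<phi> by (intro max_ext_map_le)
qed

lemma thompson_G_eqI:
  fixes Q :: "'a::finite list set"
  assumes "finite Q" "maximal_prefix_code Q" "\<phi> \<in> carrier thompson_G" "\<psi> \<in> carrier thompson_G"
    and "\<And>q. q \<in> Q \<Longrightarrow> \<phi> q = Some (f q)" "\<And>q. q \<in> Q \<Longrightarrow> \<psi> q = Some (f q)"
  shows "\<phi> = \<psi>"
  using represented_unique[OF assms(1-3,5)] represented_unique[OF assms(1,2,4,6)] by simp

text \<open>Membership becomes a property of the group element itself, so that the closure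
  properties below involve no choice of a representing permutation.\<close>

lemma Sym_code_iff:
  fixes Q :: "'a::finite list set"
  assumes Q: "finite Q" "maximal_prefix_code Q"
  shows "\<phi> \<in> Sym_code Q \<longleftrightarrow>
    \<phi> \<in> carrier thompson_G \<and> Q \<subseteq> dom \<phi> \<and> (\<lambda>x. the (\<phi> x)) ` Q = Q"
proof
  assume "\<phi> \<in> Sym_code Q"
  then obtain \<pi> where \<pi>: "\<pi> permutes Q" "\<phi> = represented Q \<pi>" by (auto simp: Sym_code_def)
  have *: "inj_on \<pi> Q" "\<pi> ` Q = Q"
    by (fact permutes_inj_on[OF \<pi>(1)] permutes_image[OF \<pi>(1)])+
  then have "\<phi> q = Some (\<pi> q)" if "q \<in> Q" for q
    using represented_eq_Some[OF Q, of \<pi>] Q that \<pi> by simp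
  moreover have "\<phi> \<in> carrier thompson_G"
    using represented_in_carrier[OF Q, of \<pi>] * Q \<pi> by simp
  ultimately show "\<phi> \<in> carrier thompson_G \<and> Q \<subseteq> dom \<phi> \<and> (\<lambda>x. the (\<phi> x)) ` Q = Q"
    using *(2) by (simp add: domI subsetI)
next
  assume \<phi>: "\<phi> \<in> carrier thompson_G \<and> Q \<subseteq> dom \<phi> \<and> (\<lambda>x. the (\<phi> x)) ` Q = Q"
  \<comment> \<open>Off \<open>Q\<close> the value is \<open>q\<close>, as \<open>permutes\<close>
    demands; injectivity on \<open>Q\<close> follows from surjectivity by finiteness.\<close>
  define \<pi> where "\<pi> q = (if q \<in> Q then the (\<phi> q) else q)" for q
  have "inj_on \<pi> Q" using \<phi> Q(1) by (intro eq_card_imp_inj_on) (auto simp: \<pi>_def)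
  then have "\<pi> permutes Q" using \<phi> by (intro bij_imp_permutes) (auto simp: bij_betw_def \<pi>_def)
  moreover have "represented Q \<pi> = \<phi>" using \<phi> by (intro represented_unique Q) (auto simp: \<pi>_def)
  ultimately show "\<phi> \<in> Sym_code Q" by (auto simp: Sym_code_def)
qed

lemma subgroup_Sym_code:
  fixes Q :: "'a::finite list set"
  assumes Q: "finite Q" "maximal_prefix_code Q"
  shows "subgroup (Sym_code Q) thompson_G"
proof -
  interpret group "thompson_G :: ('a list \<rightharpoonup> 'a list) monoid" by (rule group_thompson_G)
  note iff = Sym_code_iff[OF Q]
  show ?thesis
  proof (rule subgroupI)
    show "Sym_code Q \<subseteq> carrier thompson_G" using iff by blast
    show "Sym_code Q \<noteq> {}" using iff[of Some] Some_in_carrier by auto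
    fix \<phi> assume \<phi>: "\<phi> \<in> Sym_code Q"
    have ex: "\<exists>x\<in>Q. \<phi> x = Some y" if "y \<in> Q" for y
    proof -
      have "y \<in> (\<lambda>x. the (\<phi> x)) ` Q" using \<phi> that by (simp add: iff)
      then obtain x where "x \<in> Q" "y = the (\<phi> x)" by blast
      moreover have "x \<in> dom \<phi>" using \<phi> \<open>x \<in> Q\<close> iff by blast
      ultimately show ?thesis by auto
    qed
    have inv: "(inv\<^bsub>thompson_G\<^esub> \<phi>) y = Some x \<longleftrightarrow> \<phi> x = Some y" for x y
      using \<phi> by (intro thompson_G_inv_eq_Some_iff) (simp add: iff)
    have "(\<lambda>x. the ((inv\<^bsub>thompson_G\<^esub> \<phi>) x)) ` Q = Q"
    proof (rule endo_inj_surj)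
      show "(\<lambda>x. the ((inv\<^bsub>thompson_G\<^esub> \<phi>) x)) ` Q \<subseteq> Q"
      proof (rule image_subsetI)
        fix y assume "y \<in> Q"
        then obtain x where "x \<in> Q" "\<phi> x = Some y" using ex by blast
        then show "the ((inv\<^bsub>thompson_G\<^esub> \<phi>) y) \<in> Q" by (simp add: inv[symmetric])
      qed
      show "inj_on (\<lambda>x. the ((inv\<^bsub>thompson_G\<^esub> \<phi>) x)) Q"
      proof (rule inj_onI)
        fix a b assume ab: "a \<in> Q" "b \<in> Q"
          and eq: "the ((inv\<^bsub>thompson_G\<^esub> \<phi>) a) = the ((inv\<^bsub>thompson_G\<^esub> \<phi>) b)"
        obtain x y where "\<phi> x = Some a" "\<phi> y = Some b" using ex ab by blast
        moreover from this have "x = y" using eq by (simp add: inv[symmetric])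
        ultimately show "a = b" by simp
      qed
    qed (rule Q(1))
    moreover have "Q \<subseteq> dom (inv\<^bsub>thompson_G\<^esub> \<phi>)" using ex inv by blast
    ultimately show "inv\<^bsub>thompson_G\<^esub> \<phi> \<in> Sym_code Q" using \<phi> by (simp add: iff)
    fix \<psi> assume \<psi>: "\<psi> \<in> Sym_code Q"
    have comp: "(\<phi> \<otimes>\<^bsub>thompson_G\<^esub> \<psi>) q = Some (the (\<phi> (the (\<psi> q))))" if "q \<in> Q" for q
    proof (rule thompson_G_mult_eq_Some)
      show "\<psi> q = Some (the (\<psi> q))" using that \<psi> by (auto simp: iff)
      have "the (\<psi> q) \<in> Q" using that \<psi> unfolding iff by blast
      then show "\<phi> (the (\<psi> q)) = Some (the (\<phi> (the (\<psi> q))))" using \<phi> by (auto simp: iff)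
    qed (use \<phi> \<psi> iff in auto)
    have "(\<lambda>q. the ((\<phi> \<otimes>\<^bsub>thompson_G\<^esub> \<psi>) q)) ` Q = (\<lambda>q. the (\<phi> q)) ` (\<lambda>q. the (\<psi> q)) ` Q"
      using comp by (auto simp: image_image)
    also have "\<dots> = Q" using \<phi> \<psi> by (simp add: iff)
    finally show "\<phi> \<otimes>\<^bsub>thompson_G\<^esub> \<psi> \<in> Sym_code Q" using \<phi> \<psi> comp by (auto simp: iff)
  qed
qed

text \<open>This is the embedding by tensoring with the identity of the alphabet. Inside the group
  it is an inclusion: by equivariance the same element acts on the refined code by
  \<open>q @ [a]\<close> going to \<open>\<phi> q @ [a]\<close>.\<close>

lemma Sym_code_power_mono:
  fixes P :: "'a::finite list set"
  assumes P: "finite P" "maximal_prefix_code P" and "m \<le> n"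
  shows "Sym_code (code_power P m) \<subseteq> Sym_code (code_power P n)"
  using \<open>m \<le> n\<close>
proof (induction n rule: dec_induct)
  case (step n)
  have "Sym_code (code_power P n) \<subseteq> Sym_code (code_power P (Suc n))"
  proof
    note iff = Sym_code_iff[OF finite_code_power[OF P(1)] maximal_prefix_code_code_power[OF P]]
    fix \<phi> assume \<phi>: "\<phi> \<in> Sym_code (code_power P n)"
    have "\<phi> (q @ [a]) = Some (the (\<phi> q) @ [a])" if "q \<in> code_power P n" for q a
      using \<phi> that by (intro equivariantD fg_essential_isoD carrier_thompson_G_fg) (auto simp: iff)
    moreover have "(\<lambda>q. the (\<phi> q)) ` code_power P n = code_power P n" using \<phi> by (simp add: iff)
    ultimately have "code_power P (Suc n) \<subseteq> dom \<phi>"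
      "(\<lambda>q. the (\<phi> q)) ` code_power P (Suc n) = code_power P (Suc n)"
      unfolding code_power_Suc by (auto simp: image_iff) (metis (no_types, lifting) image_iff option.sel)+
    then show "\<phi> \<in> Sym_code (code_power P (Suc n))" using \<phi> by (simp add: iff)
  qed
  then show ?case using step by blast
qed simp

text \<open>The union is directed: factors from levels \<open>m\<close> and \<open>n\<close> both
  belong to level \<open>max m n\<close>.\<close>

lemma subgroup_Sym_union:
  fixes P :: "'a::finite list set"
  assumes P: "finite P" "maximal_prefix_code P"
  shows "subgroup (Sym_union P) thompson_G"
proof -
  interpret group "thompson_G :: ('a list \<rightharpoonup> 'a list) monoid" by (rule group_thompson_G)
  have sub: "subgroup (Sym_code (code_power P n)) thompson_G" for n
    by (intro subgroup_Sym_code finite_code_power maximal_prefix_code_code_power P)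
  show ?thesis
  proof (rule subgroupI)
    show "Sym_union P \<subseteq> carrier thompson_G" using sub by (auto simp: Sym_union_def dest: subgroup.subset)
    show "Sym_union P \<noteq> {}" using subgroup.one_closed[OF sub[of 1]] by (auto simp: Sym_union_def)
    show "inv\<^bsub>thompson_G\<^esub> \<phi> \<in> Sym_union P" if "\<phi> \<in> Sym_union P" for \<phi>
      using that subgroup.m_inv_closed[OF sub] unfolding Sym_union_def by blast
    show "\<phi> \<otimes>\<^bsub>thompson_G\<^esub> \<psi> \<in> Sym_union P" if union: "\<phi> \<in> Sym_union P" "\<psi> \<in> Sym_union P" for \<phi> \<psi>
    proof -
      obtain m n where "m \<ge> 1" "\<phi> \<in> Sym_code (code_power P m)" "\<psi> \<in> Sym_code (code_power P n)"
        using union unfolding Sym_union_def by auto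
      then have "\<phi> \<otimes>\<^bsub>thompson_G\<^esub> \<psi> \<in> Sym_code (code_power P (max m n))"
        using Sym_code_power_mono[OF P, of m "max m n"] Sym_code_power_mono[OF P, of n "max m n"]
        by (intro subgroup.m_closed[OF sub]) auto
      then show ?thesis using \<open>m \<ge> 1\<close> by (auto simp: Sym_union_def intro!: bexI[of _ "max m n"])
    qed
  qed
qed

section \<open>Order and cyclic order\<close>

text \<open>Incomparable words are compared at their first differing letter, which the suffixes do
  not reach.\<close>

lemma parallel_append_less_iff:
  fixes x y :: "'a::linorder list"
  assumes "x \<parallel> y"
  shows "x @ u < y @ v \<longleftrightarrow> x < y"
proof -
  obtain p b bs c cs where "b \<noteq> c" "x = p @ b # bs" "y = p @ c # cs"
    using parallel_decomp[OF assms] by blast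
  then show ?thesis by (induction p arbitrary: x y) auto
qed

lemma parallel_append_le_iff:
  fixes x y :: "'a::linorder list"
  assumes "x \<parallel> y"
  shows "x @ u \<le> y @ v \<longleftrightarrow> x \<le> y"
  using assms parallel_append_less_iff[OF assms, of u v] parallel_append[OF assms, of u v]
  unfolding list_le_def by (metis parallel_def prefix_order.order_refl)

lemma prefix_imp_le: "prefix x y \<Longrightarrow> x \<le> (y :: 'a::linorder list)"
proof (induction x arbitrary: y)
  case (Cons a x)
  then show ?case by (cases y) auto
qed simp

text \<open>
  Both \<open>F\<close> and \<open>T\<close> consist of the elements that preserve a property of lists of pairwise
  prefix-incomparable words. Incomparability makes the property insensitive to extending the words
  on the right, so that it passes to maximal extensions.
\<close>

definition preserves :: "('a list list \<Rightarrow> bool) \<Rightarrow> ('a list \<rightharpoonup> 'a list) \<Rightarrow> bool" where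
  "preserves C \<phi> \<longleftrightarrow> (\<forall>xs. set xs \<subseteq> dom \<phi> \<longrightarrow> sorted_wrt (\<parallel>) xs \<longrightarrow>
     C (map (\<lambda>x. the (\<phi> x)) xs) = C xs)"

definition stable :: "('a list list \<Rightarrow> bool) \<Rightarrow> bool" where
  "stable C \<longleftrightarrow> (\<forall>xs z. sorted_wrt (\<parallel>) xs \<longrightarrow> C (map (\<lambda>x. x @ z) xs) = C xs)"

lemma fg_essential_iso_parallel_iff:
  fixes \<phi> :: "'a::finite list \<rightharpoonup> 'a list"
  assumes "fg_essential_iso \<phi>" "x \<in> dom \<phi>" "y \<in> dom \<phi>"
  shows "the (\<phi> x) \<parallel> the (\<phi> y) \<longleftrightarrow> x \<parallel> y"
  using assms(2,3) fg_essential_iso_prefix_iff[OF assms(1)] by (auto simp: parallel_def)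

lemma fg_essential_iso_sorted_wrt_parallel:
  fixes \<phi> :: "'a::finite list \<rightharpoonup> 'a list"
  assumes "fg_essential_iso \<phi>" "set xs \<subseteq> dom \<phi>" "sorted_wrt (\<parallel>) xs"
  shows "sorted_wrt (\<parallel>) (map (\<lambda>x. the (\<phi> x)) xs)"
  unfolding sorted_wrt_map
  by (rule sorted_wrt_mono_rel[OF _ assms(3)])
    (use assms(2) fg_essential_iso_parallel_iff[OF assms(1)] in blast)

lemma preserves_map_le:
  fixes \<phi> \<psi> :: "'a::finite list \<rightharpoonup> 'a list"
  assumes C: "stable C" and \<phi>: "fg_essential_iso \<phi>" "preserves C \<phi>"
    and \<psi>: "fg_essential_iso \<psi>" and le: "\<phi> \<subseteq>\<^sub>m \<psi>"
  shows "preserves C \<psi>"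
  unfolding preserves_def
proof (intro allI impI)
  fix xs :: "'a list list" assume xs: "set xs \<subseteq> dom \<psi>" "sorted_wrt (\<parallel>) xs"
  \<comment> \<open>As \<open>xs\<close> is finite, one suffix \<open>z\<close> carries all its
    members into the smaller domain. There \<open>\<phi>\<close> can be applied, and stability
    removes \<open>z\<close> again on both the source and the image side.\<close>
  have *: "\<forall>\<^sub>F z in long_words. \<forall>x\<in>set xs. x @ z \<in> dom \<phi>"
    by (intro eventually_ball_finite ballI eventually_append fg_essential_isoD \<phi>) simp
  obtain z where z: "\<forall>x\<in>set xs. x @ z \<in> dom \<phi>" using * by (rule eventually_long_wordsE)
  have \<phi>z: "the (\<phi> (x @ z)) = the (\<psi> x) @ z" if "x \<in> set xs" for x
  proof -
    have "\<psi> (x @ z) = Some (the (\<psi> x) @ z)"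
      using that xs(1) by (intro equivariantD fg_essential_isoD \<psi>) auto
    then show ?thesis using bspec[OF z that] le by (simp add: map_le_def)
  qed
  have par: "sorted_wrt (\<parallel>) (map (\<lambda>x. x @ z) xs)"
    unfolding sorted_wrt_map by (rule sorted_wrt_mono_rel[OF _ xs(2)]) (rule parallel_append)
  have "C (map (\<lambda>x. the (\<psi> x)) xs) = C (map (\<lambda>x. x @ z) (map (\<lambda>x. the (\<psi> x)) xs))"
    using C fg_essential_iso_sorted_wrt_parallel[OF \<psi> xs] unfolding stable_def by blast
  also have "map (\<lambda>x. x @ z) (map (\<lambda>x. the (\<psi> x)) xs) = map (\<lambda>x. the (\<phi> x)) (map (\<lambda>x. x @ z) xs)"
    by (simp add: \<phi>z)
  also have "C \<dots> = C (map (\<lambda>x. x @ z) xs)"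
    using \<phi>(2) par z unfolding preserves_def by (metis (no_types, lifting) image_subsetI list.set_map)
  also have "\<dots> = C xs" using C xs(2) unfolding stable_def by blast
  finally show "C (map (\<lambda>x. the (\<psi> x)) xs) = C xs" .
qed

lemma preserves_max_ext:
  fixes \<phi> :: "'a::finite list \<rightharpoonup> 'a list"
  assumes "stable C" "fg_essential_iso \<phi>" "preserves C \<phi>"
  shows "preserves C (max_ext \<phi>)"
  using assms carrier_thompson_G_fg max_ext_in_carrier map_le_max_ext by (blast intro: preserves_map_le)

lemma preserves_comp:
  fixes \<phi> \<psi> :: "'a::finite list \<rightharpoonup> 'a list"
  assumes "preserves C \<phi>" "preserves C \<psi>" "fg_essential_iso \<psi>"
  shows "preserves C (\<phi> \<circ>\<^sub>m \<psi>)"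
  unfolding preserves_def
proof (intro allI impI)
  fix xs :: "'a list list" assume xs: "set xs \<subseteq> dom (\<phi> \<circ>\<^sub>m \<psi>)" "sorted_wrt (\<parallel>) xs"
  have *: "x \<in> dom \<psi>" "the (\<psi> x) \<in> dom \<phi>" "(\<phi> \<circ>\<^sub>m \<psi>) x = \<phi> (the (\<psi> x))" if "x \<in> set xs" for x
  proof -
    have "x \<in> dom (\<phi> \<circ>\<^sub>m \<psi>)" using that xs(1) by blast
    then show "x \<in> dom \<psi>" "the (\<psi> x) \<in> dom \<phi>" "(\<phi> \<circ>\<^sub>m \<psi>) x = \<phi> (the (\<psi> x))"
      by (auto simp: map_comp_def split: option.splits)
  qed
  then have sub: "set xs \<subseteq> dom \<psi>" by blast
  have "map (\<lambda>x. the ((\<phi> \<circ>\<^sub>m \<psi>) x)) xs = map (\<lambda>x. the (\<phi> x)) (map (\<lambda>x. the (\<psi> x)) xs)"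
    using *(3) by simp
  also have "C \<dots> = C (map (\<lambda>x. the (\<psi> x)) xs)"
    using assms(1) fg_essential_iso_sorted_wrt_parallel[OF assms(3) sub xs(2)] *(2)
    unfolding preserves_def by (metis (no_types, lifting) image_subsetI list.set_map)
  also have "\<dots> = C xs" using assms(2) sub xs(2) unfolding preserves_def by blast
  finally show "C (map (\<lambda>x. the ((\<phi> \<circ>\<^sub>m \<psi>) x)) xs) = C xs" .
qed

lemma preserves_inverse_map:
  fixes \<phi> :: "'a::finite list \<rightharpoonup> 'a list"
  assumes "preserves C \<phi>" "fg_essential_iso \<phi>"
  shows "preserves C (inverse_map \<phi>)"
  unfolding preserves_def
proof (intro allI impI)
  note inv = inverse_map_eq_Some_iff[OF fg_essential_isoD(2)[OF assms(2)]]
  fix xs :: "'a list list" assume xs: "set xs \<subseteq> dom (inverse_map \<phi>)" "sorted_wrt (\<parallel>) xs"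
  define ys where "ys = map (\<lambda>x. the (inverse_map \<phi> x)) xs"
  have *: "\<phi> (the (inverse_map \<phi> x)) = Some x" if "x \<in> set xs" for x
    using that xs(1) by (auto simp: inv[symmetric])
  then have "map (\<lambda>x. the (\<phi> x)) ys = xs" by (simp add: ys_def map_idI)
  moreover have "set ys \<subseteq> dom \<phi>" using * by (auto simp: ys_def)
  moreover have "sorted_wrt (\<parallel>) ys"
    unfolding ys_def by (intro fg_essential_iso_sorted_wrt_parallel fg_essential_iso_inverse_map assms xs)
  ultimately have "C xs = C ys" using assms(1) unfolding preserves_def by metis
  then show "C (map (\<lambda>x. the (inverse_map \<phi> x)) xs) = C xs" by (simp add: ys_def)
qed

text \<open>Applied with \<open>C\<close> as \<open>sorted\<close> this yields \<open>F\<close>,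
  with \<open>cyclic_list\<close> it yields \<open>T\<close>.\<close>

lemma subgroup_preserves:
  fixes C :: "'a::finite list list \<Rightarrow> bool"
  assumes "stable C"
  shows "subgroup {\<phi> \<in> carrier thompson_G. preserves C \<phi>} thompson_G"
proof -
  interpret group "thompson_G :: ('a list \<rightharpoonup> 'a list) monoid" by (rule group_thompson_G)
  show ?thesis
  proof (rule subgroupI)
    have "preserves C Some" by (simp add: preserves_def)
    then show "{\<phi> \<in> carrier thompson_G. preserves C \<phi>} \<noteq> {}" using Some_in_carrier by blast
    show "inv\<^bsub>thompson_G\<^esub> \<phi> \<in> {\<phi> \<in> carrier thompson_G. preserves C \<phi>}"
      if "\<phi> \<in> {\<phi> \<in> carrier thompson_G. preserves C \<phi>}" for \<phi>
      using that
      by (auto simp: thompson_G_inv[of \<phi>] carrier_thompson_G_fg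
          intro!: preserves_max_ext max_ext_in_carrier preserves_inverse_map fg_essential_iso_inverse_map assms)
    show "\<phi> \<otimes>\<^bsub>thompson_G\<^esub> \<psi> \<in> {\<phi> \<in> carrier thompson_G. preserves C \<phi>}"
      if "\<phi> \<in> {\<phi> \<in> carrier thompson_G. preserves C \<phi>}" "\<psi> \<in> {\<phi> \<in> carrier thompson_G. preserves C \<phi>}" for \<phi> \<psi>
      using that
      by (auto simp: mult_thompson_G carrier_thompson_G_fg
          intro!: preserves_max_ext max_ext_in_carrier preserves_comp fg_essential_iso_comp assms)
  qed auto
qed

section \<open>Description of \<open>F\<close> by incomparable pairs\<close>

lemma sorted_wrt_cong_under:
  assumes "sorted_wrt P xs"
    and "\<And>a b. a \<in> set xs \<Longrightarrow> b \<in> set xs \<Longrightarrow> P a b \<Longrightarrow> Q a b \<longleftrightarrow> R a b"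
  shows "sorted_wrt Q xs \<longleftrightarrow> sorted_wrt R xs"
  using assms by (induction xs) auto

lemma stable_sorted: "stable (sorted :: 'a::linorder list list \<Rightarrow> bool)"
  unfolding stable_def sorted_map
  by (intro allI impI) (erule sorted_wrt_cong_under, rule parallel_append_le_iff)

lemma parallel_linear: "x \<parallel> y \<Longrightarrow> x < y \<or> y < (x :: 'a::linorder list)"
  by (metis linorder_less_linear parallelD1 prefix_order.order_refl)

lemma thompson_F_eq:
  "(thompson_F :: ('a::{finite,linorder} list \<rightharpoonup> 'a list) set) = {\<phi> \<in> carrier thompson_G. preserves sorted \<phi>}"
proof -
  have "preserves sorted \<phi> \<longleftrightarrow> (\<forall>x\<in>dom \<phi>. \<forall>y\<in>dom \<phi>. x \<le> y \<longrightarrow> the (\<phi> x) \<le> the (\<phi> y))" (is "_ \<longleftrightarrow> ?mono")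
    if "fg_essential_iso \<phi>" for \<phi> :: "'a list \<rightharpoonup> 'a list"
  proof
    assume pres: "preserves sorted \<phi>"
    show ?mono
    proof (intro ballI impI)
      fix x y assume xy: "x \<in> dom \<phi>" "y \<in> dom \<phi>" "x \<le> y"
      \<comment> \<open>If \<open>y\<close> is a prefix of \<open>x\<close>, then
        \<open>y \<le> x\<close> and hence \<open>x = y\<close>. The prefix case then needs only
        equivariance, and order preservation matters for incomparable words alone.\<close>
      consider "prefix x y" | "x \<parallel> y" using xy(3) prefix_imp_le[of y x] by (metis dual_order.antisym parallelI prefix_order.order_refl)
      then show "the (\<phi> x) \<le> the (\<phi> y)"
      proof cases
        case 1
        then show ?thesis
          using xy fg_essential_iso_prefix_iff[OF that] by (intro prefix_imp_le) auto
      next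
        case 2
        then have "sorted (map (\<lambda>x. the (\<phi> x)) [x, y]) = sorted [x, y]"
          using pres xy by (intro pres[unfolded preserves_def, rule_format]) auto
        then show ?thesis using xy(3) by simp
      qed
    qed
  next
    assume mono: ?mono
    \<comment> \<open>A monotone injection between linear orders also reflects the order; this gives
      the equivalence required by \<open>preserves\<close>.\<close>
    have "the (\<phi> x) \<le> the (\<phi> y) \<longleftrightarrow> x \<le> y" if "x \<in> dom \<phi>" "y \<in> dom \<phi>" for x y
      using that mono fg_essential_iso_inj[OF \<open>fg_essential_iso \<phi>\<close>, of x _ y]
      by (metis domD linorder_linear option.sel order_antisym)
    then show "preserves sorted \<phi>"
      unfolding preserves_def sorted_map
      by (intro allI impI) (erule sorted_wrt_cong_under, blast)
  qed
  then show ?thesis by (auto simp: thompson_F_def carrier_thompson_G)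
qed

section \<open>Cyclic order, and the description of \<open>T\<close> by incomparable triples\<close>

definition cyc :: "'b::linorder \<Rightarrow> 'b \<Rightarrow> 'b \<Rightarrow> bool" where
  "cyc a b c \<longleftrightarrow> a < b \<and> b < c \<or> b < c \<and> c < a \<or> c < a \<and> a < b"

text \<open>Every triple taken in list order is positively oriented for \<open>cyc\<close>, the
  cyclic order induced by a linear order. Lists of at most two entries always qualify, even with a
  repeated entry, hence the separate \<open>distinct\<close> where listings of codes are
  meant.\<close>

fun cyclic_list :: "'b::linorder list \<Rightarrow> bool" where
  "cyclic_list [] \<longleftrightarrow> True"
| "cyclic_list (x # xs) \<longleftrightarrow> sorted_wrt (cyc x) xs \<and> cyclic_list xs"

lemma cyc_rotate: "cyc a b c \<longleftrightarrow> cyc c a b"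
  by (auto simp: cyc_def)

lemma cyc_swap: "a \<noteq> b \<Longrightarrow> a \<noteq> c \<Longrightarrow> b \<noteq> c \<Longrightarrow> cyc a c b \<longleftrightarrow> \<not> cyc a b c"
  by (auto simp: cyc_def)

lemma cyclic_list_snoc: "cyclic_list (ys @ [x]) \<longleftrightarrow> cyclic_list (x # ys)"
  by (induction ys) (auto simp: sorted_wrt_append cyc_rotate[of _ _ x])

lemma cyclic_list_rotate: "cyclic_list (rotate n xs) \<longleftrightarrow> cyclic_list xs"
proof (induction n)
  case (Suc n)
  have "cyclic_list (rotate1 ys) \<longleftrightarrow> cyclic_list ys" for ys :: "'a list"
    by (cases ys) (simp_all only: rotate1.simps cyclic_list_snoc)
  then show ?case using Suc by simp
qed simp

lemma cyclic_list_sorted: "sorted_wrt (<) xs \<Longrightarrow> cyclic_list xs"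
proof (induction xs)
  case (Cons x xs)
  then have "sorted_wrt (cyc x) xs"
    by (auto intro!: sorted_wrt_mono_rel[of xs "(<)" "cyc x"] simp: cyc_def)
  then show ?case using Cons by simp
qed simp

text \<open>Rotate the minimum \<open>m\<close> to the front. Since \<open>m\<close> lies below all
  other entries, \<open>cyc m b c\<close> says just \<open>b < c\<close>, so the rotated list is the
  increasing listing.\<close>

lemma cyclic_list_iff_rotate:
  assumes "distinct xs"
  shows "cyclic_list xs \<longleftrightarrow> (\<exists>j. xs = rotate j (sorted_list_of_set (set xs)))"
proof
  assume "\<exists>j. xs = rotate j (sorted_list_of_set (set xs))"
  then show "cyclic_list xs"
    by (metis cyclic_list_rotate cyclic_list_sorted strict_sorted_list_of_set)
next
  assume xs: "cyclic_list xs"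
  show "\<exists>j. xs = rotate j (sorted_list_of_set (set xs))"
  proof (cases "xs = []")
    case False
    define m where "m = Min (set xs)"
    have "m \<in> set xs" using False by (simp add: m_def)
    then obtain ys zs where split: "xs = ys @ m # zs" by (meson split_list)
    have rot: "rotate (length ys) xs = m # zs @ ys" by (simp add: split rotate_append)
    have "sorted_wrt (cyc m) (zs @ ys)" using xs rot cyclic_list_rotate[of "length ys" xs] by simp
    moreover have less: "m < x" if "x \<in> set (zs @ ys)" for x
    proof -
      have "m \<le> x" using that unfolding m_def by (intro Min_le) (auto simp: split)
      then show ?thesis using that assms split by force
    qed
    ultimately have "sorted_wrt (<) (zs @ ys)"
      by (elim sorted_wrt_mono_rel[rotated]) (auto simp: cyc_def dest: less_asym)
    then have "sorted (m # zs @ ys)" using less by (auto simp: less_imp_le strict_sorted_iff)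
    moreover have "distinct (m # zs @ ys)" "set (m # zs @ ys) = set xs" using assms by (auto simp: split)
    ultimately have "sorted_list_of_set (set xs) = rotate (length ys) xs"
      unfolding rot by (metis sorted_list_of_set.idem_if_sorted_distinct)
    moreover have "length xs - length ys + length ys = length xs" by (simp add: split)
    then have "rotate (length xs - length ys) (rotate (length ys) xs) = xs"
      by (simp only: rotate_rotate) simp
    ultimately show ?thesis by metis
  qed simp
qed

lemma cyclic_list_map_cong:
  assumes "sorted_wrt P xs"
    and "\<And>a b c. a \<in> set xs \<Longrightarrow> b \<in> set xs \<Longrightarrow> c \<in> set xs \<Longrightarrow> P a b \<Longrightarrow> P a c \<Longrightarrow> P b c \<Longrightarrow>
      cyc (f a) (f b) (f c) \<longleftrightarrow> cyc a b c"
  shows "cyclic_list (map f xs) \<longleftrightarrow> cyclic_list xs"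
  using assms
proof (induction xs)
  case (Cons x xs)
  have "sorted_wrt (\<lambda>a b. cyc (f x) (f a) (f b)) xs \<longleftrightarrow> sorted_wrt (cyc x) xs"
    by (rule sorted_wrt_cong_under[of P]) (use Cons.prems in auto)
  then show ?case using Cons by (auto simp: sorted_wrt_map)
qed simp

lemma parallel_append_cyc_iff:
  fixes x y z :: "'a::linorder list"
  assumes "x \<parallel> y" "x \<parallel> z" "y \<parallel> z"
  shows "cyc (x @ u) (y @ v) (z @ w) \<longleftrightarrow> cyc x y z"
proof -
  have "z \<parallel> x" using assms(2) by (simp add: parallel_commute)
  then show ?thesis using assms by (simp add: cyc_def parallel_append_less_iff)
qed

lemma stable_cyclic_list: "stable (cyclic_list :: 'a::linorder list list \<Rightarrow> bool)"
  unfolding stable_def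
  by (intro allI impI) (erule cyclic_list_map_cong, rule parallel_append_cyc_iff)

text \<open>One implication suffices: of three distinct words exactly one of the two orientations
  holds, so preserving both orientations also reflects them (\<open>cyc_swap\<close>).\<close>

lemma preserves_cyclic_listI:
  fixes \<phi> :: "'a::{finite,linorder} list \<rightharpoonup> 'a list"
  assumes \<phi>: "fg_essential_iso \<phi>"
    and cyc: "\<And>x y z. x \<in> dom \<phi> \<Longrightarrow> y \<in> dom \<phi> \<Longrightarrow> z \<in> dom \<phi> \<Longrightarrow> x \<parallel> y \<Longrightarrow> x \<parallel> z \<Longrightarrow> y \<parallel> z \<Longrightarrow>
      cyc x y z \<Longrightarrow> cyc (the (\<phi> x)) (the (\<phi> y)) (the (\<phi> z))"
  shows "preserves cyclic_list \<phi>"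
  unfolding preserves_def
proof (intro allI impI cyclic_list_map_cong)
  fix xs x y z
  assume *: "set xs \<subseteq> dom \<phi>" "x \<in> set xs" "y \<in> set xs" "z \<in> set xs" "x \<parallel> y" "x \<parallel> z" "y \<parallel> z"
  then have neq: "x \<noteq> y" "x \<noteq> z" "y \<noteq> z" by auto
  have "z \<parallel> y" using \<open>y \<parallel> z\<close> by (simp add: parallel_commute)
  have "the (\<phi> x) \<noteq> the (\<phi> y)" "the (\<phi> x) \<noteq> the (\<phi> z)" "the (\<phi> y) \<noteq> the (\<phi> z)"
    using * fg_essential_iso_parallel_iff[OF \<phi>] by (auto simp: subset_iff) (metis parallelD1 prefix_order.order_refl)+
  then show "cyc (the (\<phi> x)) (the (\<phi> y)) (the (\<phi> z)) \<longleftrightarrow> cyc x y z"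
    using * cyc[of x y z] cyc[of x z y] \<open>z \<parallel> y\<close> cyc_swap[OF neq] cyc_swap[of "the (\<phi> x)" "the (\<phi> y)" "the (\<phi> z)"]
    by blast
qed

text \<open>Separates the code condition, invariant under every isomorphism, from the purely
  order-theoretic one, which alone distinguishes \<open>T\<close>.\<close>

lemma cyclical_code_order_iff:
  fixes xs :: "'a::linorder list list"
  shows "cyclical_code_order xs \<longleftrightarrow> maximal_prefix_code (set xs) \<and> distinct xs \<and> cyclic_list xs"
proof
  assume "cyclical_code_order xs"
  then obtain Q j where Q: "finite Q" "maximal_prefix_code Q" "xs = rotate j (sorted_list_of_set Q)"
    by (auto simp: cyclical_code_order_def cyclical_order_def)
  then have "set xs = Q" "distinct xs" by auto
  then show "maximal_prefix_code (set xs) \<and> distinct xs \<and> cyclic_list xs"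
    using Q cyclic_list_iff_rotate[of xs] by blast
next
  assume "maximal_prefix_code (set xs) \<and> distinct xs \<and> cyclic_list xs"
  then show "cyclical_code_order xs"
    using cyclic_list_iff_rotate[of xs] unfolding cyclical_code_order_def cyclical_order_def by blast
qed

lemma cyclic_list_map_cyc:
  assumes ws: "sorted_wrt (<) ws" "cyclic_list (map f ws)"
    and abc: "a \<in> set ws" "b \<in> set ws" "c \<in> set ws" "cyc a b c"
  shows "cyc (f a) (f b) (f c)"
proof -
  \<comment> \<open>Increasing triples appear in list order in \<open>ws\<close>; any other triple
    satisfying \<open>cyc\<close> is a rotation of an increasing one.\<close>
  have *: "cyc (f a) (f b) (f c)" if "a < b" "b < c" "a \<in> set ws" "b \<in> set ws" "c \<in> set ws" for a b c
    using ws that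
  proof (induction ws)
    case (Cons w ws)
    show ?case
    proof (cases "a = w")
      case True
      then have "sorted_wrt (\<lambda>x y. cyc (f a) (f x) (f y)) ws" "b \<in> set ws" "c \<in> set ws"
        using Cons.prems by (auto simp: sorted_wrt_map)
      then show ?thesis
        using \<open>b < c\<close> Cons.prems(1) by (induction ws) auto
    next
      case False
      then have "a \<in> set ws" "b \<in> set ws" "c \<in> set ws" using Cons.prems by auto
      then show ?thesis using Cons by simp
    qed
  qed simp
  show ?thesis using abc * cyc_rotate unfolding cyc_def by metis
qed

lemma sorted_wrt_parallel_prefix_code:
  assumes "prefix_code (set xs)" "distinct xs"
  shows "sorted_wrt (\<parallel>) xs"
  using assms by (induction xs) (auto simp: prefix_code_def parallel_def)

lemma thompson_T_eq:
  "(thompson_T :: ('a::{finite,linorder} list \<rightharpoonup> 'a list) set) = {\<phi> \<in> carrier thompson_G. preserves cyclic_list \<phi>}"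
proof -
  have "preserves cyclic_list \<phi> \<longleftrightarrow> (\<forall>xs. set xs \<subseteq> dom \<phi> \<longrightarrow>
      (cyclical_code_order xs \<longleftrightarrow> cyclical_code_order (map (\<lambda>x. the (\<phi> x)) xs)))" (is "_ \<longleftrightarrow> ?T")
    if \<phi>: "fg_essential_iso \<phi>" for \<phi> :: "'a list \<rightharpoonup> 'a list"
  proof
    assume pres: "preserves cyclic_list \<phi>"
    show ?T
    proof (intro allI impI)
      fix xs assume xs: "set xs \<subseteq> dom \<phi>"
      have "inj_on (\<lambda>x. the (\<phi> x)) (set xs)"
        by (rule inj_onI) (metis xs subsetD domD option.sel fg_essential_iso_inj[OF \<phi>])
      moreover have "maximal_prefix_code ((\<lambda>x. the (\<phi> x)) ` set xs) \<longleftrightarrow> maximal_prefix_code (set xs)"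
        using xs by (intro maximal_prefix_code_image_iff \<phi>) auto
      moreover have "cyclic_list (map (\<lambda>x. the (\<phi> x)) xs) \<longleftrightarrow> cyclic_list xs"
        if "maximal_prefix_code (set xs)" "distinct xs"
        using pres xs sorted_wrt_parallel_prefix_code[OF _ that(2)] that(1)
        unfolding preserves_def maximal_prefix_code_def by blast
      ultimately show "cyclical_code_order xs \<longleftrightarrow> cyclical_code_order (map (\<lambda>x. the (\<phi> x)) xs)"
        unfolding cyclical_code_order_iff distinct_map set_map by blast
    qed
  next
    assume T: ?T
    show "preserves cyclic_list \<phi>"
    proof (rule preserves_cyclic_listI[OF \<phi>])
      fix x y z
      assume dom: "x \<in> dom \<phi>" "y \<in> dom \<phi>" "z \<in> dom \<phi>"
        and par: "x \<parallel> y" "x \<parallel> z" "y \<parallel> z" and cyc: "cyc x y z"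
      obtain N where N: "\<And>w. N \<le> length w \<Longrightarrow> w \<in> dom \<phi>"
        using fg_essential_isoD(3)[OF \<phi>] by (auto simp: eventually_long_words)
      \<comment> \<open>\<open>M \<ge> N\<close> places the whole code of words of length
        \<open>M\<close> in the domain, and \<open>M\<close> is large enough to pad each of
        \<open>x\<close>, \<open>y\<close>, \<open>z\<close> to a member of it.\<close>
      define M where "M = N + length x + length y + length z"
      define ws where "ws = sorted_list_of_set {w :: 'a list. length w = M}"
      have fin: "finite {w :: 'a list. length w = M}"
        using finite_lists_length_eq[OF finite_UNIV, of M] by simp
      have ws: "set ws = {w. length w = M}" "sorted_wrt (<) ws"
        using fin by (simp_all add: ws_def)
      have "cyclical_code_order ws"
        unfolding cyclical_code_order_iff ws(1)
        using maximal_prefix_code_length ws(2) cyclic_list_sorted strict_sorted_iff by blast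
      moreover have "set ws \<subseteq> dom \<phi>" unfolding ws(1) M_def by (intro subsetI N) simp
      ultimately have cyc_ws: "cyclic_list (map (\<lambda>x. the (\<phi> x)) ws)"
        using T cyclical_code_order_iff by blast
      \<comment> \<open>\<open>undefined\<close> stands for an arbitrary letter. The three suffixes
        may differ, since the cyclic order of incomparable words ignores what is appended to
        each.\<close>
      define pad where "pad w = replicate (M - length w) (undefined :: 'a)" for w :: "'a list"
      have mem: "w @ pad w \<in> set ws" if "w \<in> {x, y, z}" for w
        using that by (auto simp: ws(1) pad_def M_def)
      have "cyc (x @ pad x) (y @ pad y) (z @ pad z)" using cyc par by (simp add: parallel_append_cyc_iff)
      then have "cyc (the (\<phi> (x @ pad x))) (the (\<phi> (y @ pad y))) (the (\<phi> (z @ pad z)))"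
        using mem by (intro cyclic_list_map_cyc[OF ws(2) cyc_ws]) auto
      moreover have "the (\<phi> (w @ u)) = the (\<phi> w) @ u" if "w \<in> dom \<phi>" for w u
        using that equivariantD[OF fg_essential_isoD(1)[OF \<phi>]] by fastforce
      ultimately have "cyc (the (\<phi> x) @ pad x) (the (\<phi> y) @ pad y) (the (\<phi> z) @ pad z)"
        using dom by simp
      then show "cyc (the (\<phi> x)) (the (\<phi> y)) (the (\<phi> z))"
        using par dom by (simp add: parallel_append_cyc_iff fg_essential_iso_parallel_iff[OF \<phi>])
    qed
  qed
  then show ?thesis by (auto simp: thompson_T_def carrier_thompson_G)
qed

section \<open>Factorization\<close>

lemma preserves_sorted_less_iff:
  fixes \<phi> :: "'a::{finite,linorder} list \<rightharpoonup> 'a list"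
  assumes "preserves sorted \<phi>" "fg_essential_iso \<phi>" "x \<in> dom \<phi>" "y \<in> dom \<phi>" "x \<parallel> y"
  shows "the (\<phi> x) < the (\<phi> y) \<longleftrightarrow> x < y"
proof -
  have "sorted (map (\<lambda>x. the (\<phi> x)) [x, y]) = sorted [x, y]"
    using assms by (intro assms(1)[unfolded preserves_def, rule_format]) auto
  then have "the (\<phi> x) \<le> the (\<phi> y) \<longleftrightarrow> x \<le> y" by simp
  moreover have "the (\<phi> x) \<noteq> the (\<phi> y)" "x \<noteq> y"
    using assms(5) fg_essential_iso_parallel_iff[OF assms(2-4)] by (auto simp: parallel_def)
  ultimately show ?thesis by (simp add: order.strict_iff_order)
qed

lemma thompson_F_subset_T: "(thompson_F :: ('a::{finite,linorder} list \<rightharpoonup> 'a list) set) \<subseteq> thompson_T"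
proof
  fix \<phi> :: "'a list \<rightharpoonup> 'a list" assume "\<phi> \<in> thompson_F"
  then have \<phi>: "\<phi> \<in> carrier thompson_G" "preserves sorted \<phi>" by (auto simp: thompson_F_eq)
  note fg = carrier_thompson_G_fg[OF \<phi>(1)]
  have "preserves cyclic_list \<phi>"
  proof (rule preserves_cyclic_listI[OF fg])
    fix x y z assume *: "x \<in> dom \<phi>" "y \<in> dom \<phi>" "z \<in> dom \<phi>" "x \<parallel> y" "x \<parallel> z" "y \<parallel> z" "cyc x y z"
    then have "z \<parallel> x" by (simp add: parallel_commute)
    then show "cyc (the (\<phi> x)) (the (\<phi> y)) (the (\<phi> z))"
      using * preserves_sorted_less_iff[OF \<phi>(2) fg] by (simp add: cyc_def)
  qed
  then show "\<phi> \<in> thompson_T" using \<phi>(1) by (simp add: thompson_T_eq)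
qed

section \<open>Order properties of extended code maps\<close>

lemma prefix_code_parallel: "prefix_code Q \<Longrightarrow> p \<in> Q \<Longrightarrow> q \<in> Q \<Longrightarrow> p \<noteq> q \<Longrightarrow> p \<parallel> q"
  by (auto simp: prefix_code_def parallel_def)

lemma same_prefix_less_iff: "p @ u < p @ v \<longleftrightarrow> u < (v :: 'a::linorder list)"
  by (induction p) auto

lemma same_prefix_le_iff: "p @ u \<le> p @ v \<longleftrightarrow> u \<le> (v :: 'a::linorder list)"
  by (induction p) auto

text \<open>Two words below the same code word compare by their tails, which are copied; words below
  different code words compare as the code words do.\<close>

lemma preserves_sorted_code_ext:
  fixes Q :: "'a::{finite,linorder} list set"
  assumes Q: "finite Q" "maximal_prefix_code Q" and f: "strict_mono_on Q f" "maximal_prefix_code (f ` Q)"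
  shows "preserves sorted (code_ext Q f)"
proof -
  note cQ = maximal_prefix_codeD(1)[OF Q] and cf = maximal_prefix_codeD(1)[OF finite_imageI[OF Q(1)] f(2)]
  have mono: "f p < f q \<longleftrightarrow> p < q" if "p \<in> Q" "q \<in> Q" for p q
    using that f(1) by (simp add: strict_mono_on_less)
  have "the (code_ext Q f x) \<le> the (code_ext Q f y) \<longleftrightarrow> x \<le> y"
    if xy: "x \<in> dom (code_ext Q f)" "y \<in> dom (code_ext Q f)" for x y
  proof -
    obtain p u q v where p: "p \<in> Q" "x = p @ u" and q: "q \<in> Q" "y = q @ v"
      using xy unfolding dom_code_ext ideal_gen_def by blast
    show ?thesis
    proof (cases "p = q")
      case True
      then show ?thesis using p q code_ext_append[OF cQ] by (simp add: same_prefix_le_iff)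
    next
      case False
      then have "p \<parallel> q" using p q by (intro prefix_code_parallel[OF cQ])
      moreover have neq: "f p \<noteq> f q" using mono[OF p(1) q(1)] mono[OF q(1) p(1)] False by auto
      then have "f p \<parallel> f q" using p q by (intro prefix_code_parallel[OF cf]) auto
      moreover have "f p \<le> f q \<longleftrightarrow> p \<le> q"
        using mono[OF p(1) q(1)] False neq by (simp add: order.order_iff_strict)
      ultimately show ?thesis
        using p q code_ext_append[OF cQ] by (simp add: parallel_append_le_iff)
    qed
  qed
  then show ?thesis
    unfolding preserves_def sorted_map by (intro allI impI) (erule sorted_wrt_cong_under, blast)
qed

lemma cyc_same_prefix: "cyc (p @ u) (p @ v) (p @ w) \<longleftrightarrow> cyc u v (w :: 'a::linorder list)"
  by (simp add: cyc_def same_prefix_less_iff)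

text \<open>All words with prefix \<open>p\<close> lie on the same side of \<open>r @ w\<close>, so
  seen from there their cyclic order is the linear order of the tails.\<close>

lemma cyc_two_prefixes:
  assumes "p \<parallel> r"
  shows "cyc (p @ u) (p @ v) (r @ w) \<longleftrightarrow> u < (v :: 'a::linorder list)"
proof -
  have "r \<parallel> p" using assms by (simp add: parallel_commute)
  moreover have "p < r \<or> r < p" using assms by (rule parallel_linear)
  ultimately show ?thesis
    using assms by (auto simp: cyc_def same_prefix_less_iff parallel_append_less_iff)
qed

lemma preserves_cyclic_list_code_ext:
  fixes Q :: "'a::{finite,linorder} list set"
  assumes Q: "finite Q" "maximal_prefix_code Q" and f: "inj_on f Q" "maximal_prefix_code (f ` Q)"
    and cyc: "\<And>p q r. p \<in> Q \<Longrightarrow> q \<in> Q \<Longrightarrow> r \<in> Q \<Longrightarrow> cyc p q r \<Longrightarrow> cyc (f p) (f q) (f r)"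
  shows "preserves cyclic_list (code_ext Q f)"
proof (rule preserves_cyclic_listI[OF fg_essential_iso_code_ext[OF Q f]])
  note cQ = maximal_prefix_codeD(1)[OF Q] and cf = maximal_prefix_codeD(1)[OF finite_imageI[OF Q(1)] f(2)]
  fix x y z
  assume dom: "x \<in> dom (code_ext Q f)" "y \<in> dom (code_ext Q f)" "z \<in> dom (code_ext Q f)" and xyz: "cyc x y z"
  obtain p u q v r w where p: "p \<in> Q" "x = p @ u" and q: "q \<in> Q" "y = q @ v" and r: "r \<in> Q" "z = r @ w"
    using dom unfolding dom_code_ext ideal_gen_def by blast
  have par: "s \<parallel> t" "f s \<parallel> f t" if "s \<in> Q" "t \<in> Q" "s \<noteq> t" for s t
    using that inj_on_eq_iff[OF f(1)] prefix_code_parallel[OF cQ] prefix_code_parallel[OF cf] by auto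
  have "cyc (f p @ u) (f q @ v) (f r @ w)"
  proof (cases "p = q \<or> p = r \<or> q = r")
    case False
    then show ?thesis
      using p q r par xyz cyc[of p q r] by (simp add: parallel_append_cyc_iff)
  next
    case True
    \<comment> \<open>Where exactly two code words coincide, a rotation brings that pair to the
      front, the position treated by \<open>cyc_two_prefixes\<close>.\<close>
    then consider "p = q" "q = r" | "p = q" "q \<noteq> r" | "q = r" "p \<noteq> q" | "p = r" "p \<noteq> q" by blast
    then show ?thesis
    proof cases
      case 1
      then show ?thesis using p q r xyz by (simp add: cyc_same_prefix)
    next
      case 2
      then show ?thesis using p q r par[of q r] xyz by (simp add: cyc_two_prefixes)
    next
      case 3
      then have "cyc (q @ v) (q @ w) (p @ u)" using xyz p q r cyc_rotate by blast
      then have "cyc (f q @ v) (f q @ w) (f p @ u)" using 3 p q par[of q p] by (simp add: cyc_two_prefixes)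
      then show ?thesis using 3 cyc_rotate by blast
    next
      case 4
      then have "cyc (p @ w) (p @ u) (q @ v)" using xyz p q r cyc_rotate by blast
      then have "cyc (f p @ w) (f p @ u) (f q @ v)" using 4 p q par[of p q] by (simp add: cyc_two_prefixes)
      then show ?thesis using 4 cyc_rotate by blast
    qed
  qed
  then show "cyc (the (code_ext Q f x)) (the (code_ext Q f y)) (the (code_ext Q f z))"
    using p q r code_ext_append[OF cQ] by simp
qed

section \<open>Dictionary rotations and the cyclic groups\<close>

lemma dict_rot_nth:
  assumes "finite Q" "i < card Q"
  shows "dict_rot Q (sorted_list_of_set Q ! i) = sorted_list_of_set Q ! ((i + 1) mod card Q)"
proof -
  have "(THE j. j < card Q \<and> sorted_list_of_set Q ! j = sorted_list_of_set Q ! i) = i"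
    using assms by (intro the_equality) (auto simp: nth_eq_iff_index_eq)
  then show ?thesis by (simp add: dict_rot_def Let_def)
qed

text \<open>Seen on the whole listing the generator is a one-step rotation, so invariance of
  \<open>cyclic_list\<close> under rotation shows that it belongs to \<open>T\<close>.\<close>

lemma map_dict_rot:
  assumes "finite Q"
  shows "map (dict_rot Q) (sorted_list_of_set Q) = rotate1 (sorted_list_of_set Q)"
  using assms by (intro nth_equalityI) (auto simp: dict_rot_nth nth_rotate1)

lemma dict_rot_bij:
  assumes "finite Q"
  shows "dict_rot Q ` Q = Q" "inj_on (dict_rot Q) Q"
proof -
  show *: "dict_rot Q ` Q = Q"
    using arg_cong[OF map_dict_rot[OF assms], of set] assms by simp
  show "inj_on (dict_rot Q) Q" by (rule eq_card_imp_inj_on[OF assms arg_cong[OF *, of card]])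
qed

lemma represented_dict_rot:
  fixes Q :: "'a::{finite,linorder} list set"
  assumes Q: "finite Q" "maximal_prefix_code Q"
  shows "represented Q (dict_rot Q) \<in> Sym_code Q \<inter> thompson_T"
    and "i < card Q \<Longrightarrow> represented Q (dict_rot Q) (sorted_list_of_set Q ! i) =
      Some (sorted_list_of_set Q ! ((i + 1) mod card Q))"
proof -
  note bij = dict_rot_bij[OF Q(1)]
  have rep: "represented Q (dict_rot Q) q = Some (dict_rot Q q)" if "q \<in> Q" for q
    using that bij by (intro represented_eq_Some Q) (simp_all add: Q)
  have car: "represented Q (dict_rot Q) \<in> carrier thompson_G"
    using bij by (intro represented_in_carrier Q) (simp_all add: Q)
  have "cyc (dict_rot Q p) (dict_rot Q q) (dict_rot Q r)"
    if "p \<in> Q" "q \<in> Q" "r \<in> Q" "cyc p q r" for p q r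
  proof (rule cyclic_list_map_cyc[where f = "dict_rot Q" and ws = "sorted_list_of_set Q"])
    show "cyclic_list (map (dict_rot Q) (sorted_list_of_set Q))"
      using cyclic_list_rotate[of 1 "sorted_list_of_set Q"] cyclic_list_sorted[OF strict_sorted_list_of_set[of Q]]
      by (simp add: map_dict_rot Q)
  qed (use that Q in auto)
  then have "preserves cyclic_list (code_ext Q (dict_rot Q))"
    using bij by (intro preserves_cyclic_list_code_ext Q) (simp_all add: Q)
  moreover have "fg_essential_iso (code_ext Q (dict_rot Q))"
    using bij by (intro fg_essential_iso_code_ext Q) (simp_all add: Q)
  ultimately have "preserves cyclic_list (represented Q (dict_rot Q))"
    unfolding represented_def by (intro preserves_max_ext stable_cyclic_list)
  moreover have "(\<lambda>x. the (represented Q (dict_rot Q) x)) ` Q = Q" using rep bij(1) by simp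
  ultimately show "represented Q (dict_rot Q) \<in> Sym_code Q \<inter> thompson_T"
    using car rep by (auto simp: Sym_code_iff[OF Q] thompson_T_eq)
  show "represented Q (dict_rot Q) (sorted_list_of_set Q ! i) =
      Some (sorted_list_of_set Q ! ((i + 1) mod card Q))" if "i < card Q"
  proof -
    have "sorted_list_of_set Q ! i \<in> Q"
      using that Q(1) by (metis length_sorted_list_of_set nth_mem set_sorted_list_of_set)
    then show ?thesis using that by (simp add: rep dict_rot_nth Q(1))
  qed
qed

lemma subgroup_thompson_F: "subgroup (thompson_F :: ('a::{finite,linorder} list \<rightharpoonup> 'a list) set) thompson_G"
  unfolding thompson_F_eq by (intro subgroup_preserves stable_sorted)

lemma subgroup_thompson_T: "subgroup (thompson_T :: ('a::{finite,linorder} list \<rightharpoonup> 'a list) set) thompson_G"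
  unfolding thompson_T_eq by (intro subgroup_preserves stable_cyclic_list)

lemma Cyc_code_eq:
  fixes Q :: "'a::{finite,linorder} list set"
  assumes Q: "finite Q" "maximal_prefix_code Q"
  shows "Cyc_code Q = Sym_code Q \<inter> thompson_T"
proof
  interpret group "thompson_G :: ('a list \<rightharpoonup> 'a list) monoid" by (rule group_thompson_G)
  let ?\<rho> = "represented Q (dict_rot Q)" and ?ws = "sorted_list_of_set Q"
  note rot = represented_dict_rot[OF Q]
  show "Cyc_code Q \<subseteq> Sym_code Q \<inter> thompson_T"
    unfolding Cyc_code_def
    by (intro generate_subgroup_incl subgroups_Inter_pair subgroup_Sym_code subgroup_thompson_T Q) (use rot in blast)
  have \<rho>: "?\<rho> \<in> carrier thompson_G" using rot(1) Sym_code_iff[OF Q] by blast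
  show "Sym_code Q \<inter> thompson_T \<subseteq> Cyc_code Q"
  proof
    fix \<phi> assume \<phi>: "\<phi> \<in> Sym_code Q \<inter> thompson_T"
    then have sym: "\<phi> \<in> carrier thompson_G" "Q \<subseteq> dom \<phi>" "(\<lambda>x. the (\<phi> x)) ` Q = Q"
      by (auto simp: Sym_code_iff[OF Q])
    \<comment> \<open>The defining condition of \<open>T\<close> is applied to the listing of
      \<open>Q\<close> itself; its image is a cyclic order of the same code, which produces the
      exponent \<open>j\<close>.\<close>
    have "cyclical_code_order ?ws"
      using Q by (simp add: cyclical_code_order_iff cyclic_list_sorted)
    then have "cyclical_code_order (map (\<lambda>x. the (\<phi> x)) ?ws)"
      using \<phi> sym Q by (auto simp: thompson_T_def)
    then obtain j where j: "map (\<lambda>x. the (\<phi> x)) ?ws = rotate j ?ws"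
      using cyclic_list_iff_rotate[of "map (\<lambda>x. the (\<phi> x)) ?ws"] sym(3) Q(1)
      unfolding cyclical_code_order_iff by auto
    \<comment> \<open>The generator shifts indices by one modulo \<open>card Q\<close>. Hence its
      \<open>j\<close>-th power agrees with \<open>\<phi>\<close> on \<open>Q\<close>, and values on
      a maximal prefix code determine an element.\<close>
    have pow: "(?\<rho> [^]\<^bsub>thompson_G\<^esub> m) (?ws ! i) = Some (?ws ! ((i + m) mod card Q))"
      if "i < card Q" for i m :: nat
      using that
    proof (induction m arbitrary: i)
      case 0
      then show ?case by (simp add: one_thompson_G)
    next
      case (Suc m)
      have "(?\<rho> [^]\<^bsub>thompson_G\<^esub> m \<otimes>\<^bsub>thompson_G\<^esub> ?\<rho>) (?ws ! i) =
        Some (?ws ! (((i + 1) mod card Q + m) mod card Q))"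
      proof (rule thompson_G_mult_eq_Some)
        show "?\<rho> (?ws ! i) = Some (?ws ! ((i + 1) mod card Q))" using rot(2)[OF Suc.prems] .
        show "(?\<rho> [^]\<^bsub>thompson_G\<^esub> m) (?ws ! ((i + 1) mod card Q)) =
            Some (?ws ! (((i + 1) mod card Q + m) mod card Q))"
          using Suc.prems by (intro Suc.IH) auto
      qed (use \<rho> in auto)
      then show ?case by (simp add: mod_add_left_eq)
    qed
    have "\<phi> = ?\<rho> [^]\<^bsub>thompson_G\<^esub> j"
    proof (rule thompson_G_eqI[OF Q sym(1)])
      fix q assume q: "q \<in> Q"
      then show "\<phi> q = Some (the (\<phi> q))" using sym(2) by auto
      obtain i where i: "i < card Q" "q = ?ws ! i"
        using q Q(1) by (metis in_set_conv_nth length_sorted_list_of_set set_sorted_list_of_set)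
      then have "the (\<phi> q) = rotate j ?ws ! i" using j Q(1) by (metis nth_map length_sorted_list_of_set)
      also have "\<dots> = ?ws ! ((i + j) mod card Q)" using i by (simp add: nth_rotate add.commute)
      finally show "(?\<rho> [^]\<^bsub>thompson_G\<^esub> j) q = Some (the (\<phi> q))" using pow[OF i(1)] i(2) by simp
    qed (use \<rho> in auto)
    moreover have "?\<rho> [^]\<^bsub>thompson_G\<^esub> j \<in> generate thompson_G {?\<rho>}"
      by (induction j) (auto intro: generate.intros)
    ultimately show "\<phi> \<in> Cyc_code Q" by (simp add: Cyc_code_def)
  qed
qed

lemma Cyc_union_eq:
  fixes P :: "'a::{finite,linorder} list set"
  assumes "finite P" "maximal_prefix_code P"
  shows "Cyc_union P = Sym_union P \<inter> thompson_T"
  unfolding Cyc_union_def Sym_union_def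
  using Cyc_code_eq[OF finite_code_power[OF assms(1)] maximal_prefix_code_code_power[OF assms]] by auto

section \<open>Trivial intersection and existence of factorizations\<close>

lemma Sym_code_Int_thompson_F:
  fixes Q :: "'a::{finite,linorder} list set"
  assumes Q: "finite Q" "maximal_prefix_code Q" and \<phi>: "\<phi> \<in> Sym_code Q" "\<phi> \<in> thompson_F"
  shows "\<phi> = Some"
proof -
  let ?ws = "sorted_list_of_set Q"
  have sym: "\<phi> \<in> carrier thompson_G" "Q \<subseteq> dom \<phi>" "(\<lambda>x. the (\<phi> x)) ` Q = Q"
    using \<phi>(1) by (auto simp: Sym_code_iff[OF Q])
  have "sorted_wrt (\<parallel>) ?ws"
    using maximal_prefix_codeD(1)[OF Q] Q(1) by (intro sorted_wrt_parallel_prefix_code) auto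
  then have "sorted (map (\<lambda>x. the (\<phi> x)) ?ws) = sorted ?ws"
    using \<phi>(2) sym(2) Q(1) unfolding thompson_F_eq preserves_def by simp
  moreover have "inj_on (\<lambda>x. the (\<phi> x)) Q" using sym(3) Q(1) by (intro eq_card_imp_inj_on) auto
  ultimately have "map (\<lambda>x. the (\<phi> x)) ?ws = ?ws"
    using sym(3) Q(1) by (intro sorted_distinct_set_unique) (auto simp: distinct_map)
  then have "the (\<phi> q) = q" if "q \<in> Q" for q
    using that Q(1) by (metis map_eq_conv map_ident set_sorted_list_of_set)
  then have "\<phi> q = Some q" if "q \<in> Q" for q
    using that sym(2) by (metis domD option.sel subsetD)
  then show ?thesis by (intro thompson_G_eqI[OF Q sym(1) Some_in_carrier, of "\<lambda>q. q"]) auto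
qed

text \<open>Induction on the largest element, which is matched with the maximum of the other
  set.\<close>

lemma ex_strict_mono_bij:
  fixes A B :: "'b::linorder set"
  assumes "finite A" "finite B" "card A = card B"
  shows "\<exists>h. bij_betw h A B \<and> strict_mono_on A h"
  using assms
proof (induction A arbitrary: B rule: finite_linorder_max_induct)
  case empty
  then show ?case by (auto simp: bij_betw_def strict_mono_on_def)
next
  case (insert b A)
  then have "B \<noteq> {}" by auto
  define m where "m = Max B"
  have m: "m \<in> B" "\<And>x. x \<in> B \<Longrightarrow> x \<le> m" using insert.prems \<open>B \<noteq> {}\<close> by (auto simp: m_def)
  have "b \<notin> A" using insert.hyps by blast
  then have "card A = card (B - {m})" using insert m by simp
  then obtain h where h: "bij_betw h A (B - {m})" "strict_mono_on A h"
    using insert.IH[of "B - {m}"] insert.prems by auto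
  have "bij_betw (h(b := m)) (insert b A) (insert m (B - {m}))"
    using h(1) \<open>b \<notin> A\<close> unfolding bij_betw_def inj_on_def by auto
  moreover have "h a < m" if "a \<in> A" for a
    using bij_betwE[OF h(1)] that m(2) by (metis DiffE le_imp_less_or_eq singletonI)
  then have "strict_mono_on (insert b A) (h(b := m))"
    using h(2) insert.hyps by (auto simp: strict_mono_on_def dest: less_asym)
  ultimately show ?case using m(1) by (metis insert_Diff)
qed

lemma thompson_G_factorization:
  fixes P :: "'a::{finite,linorder} list set"
  assumes P: "finite P" "maximal_prefix_code P" and g: "g \<in> carrier thompson_G"
  shows "\<exists>\<pi>\<in>Sym_union P. \<exists>f\<in>thompson_F. g = \<pi> \<otimes>\<^bsub>thompson_G\<^esub> f"
proof -
  interpret group "thompson_G :: ('a list \<rightharpoonup> 'a list) monoid" by (rule group_thompson_G)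
  note fg = carrier_thompson_G_fg[OF g]
  obtain n where n: "n \<ge> 1" "code_power P n \<subseteq> ran g"
    using eventually_code_power[OF fg_essential_isoD(4)[OF fg] maximal_prefix_codeD(3)[OF P]] by blast
  define R where "R = code_power P n"
  have R: "finite R" "maximal_prefix_code R"
    unfolding R_def by (intro finite_code_power maximal_prefix_code_code_power P)+
  define Q where "Q = {x. \<exists>y\<in>R. g x = Some y}"
  have "R \<subseteq> (\<lambda>x. the (g x)) ` Q"
  proof
    fix y assume "y \<in> R"
    then obtain x where "g x = Some y" using n(2) by (auto simp: R_def ran_def)
    then show "y \<in> (\<lambda>x. the (g x)) ` Q" using \<open>y \<in> R\<close> by (auto simp: Q_def intro!: image_eqI[of _ _ x])
  qed
  then have gQ: "(\<lambda>x. the (g x)) ` Q = R" by (auto simp: Q_def)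
  have inj: "inj_on (\<lambda>x. the (g x)) Q"
    by (rule inj_onI) (auto simp: Q_def dest: fg_essential_iso_inj[OF fg])
  have Q: "finite Q" using inj gQ R(1) finite_imageD by metis
  have "Q \<subseteq> dom g" by (auto simp: Q_def)
  then have mQ: "maximal_prefix_code Q"
    using maximal_prefix_code_image_iff[OF fg _ Q] gQ R(2) by simp
  obtain h where h: "bij_betw h Q R" "strict_mono_on Q h"
    using ex_strict_mono_bij[OF Q R(1)] card_image[OF inj] gQ by auto
  then have hQ: "h ` Q = R" "inj_on h Q" by (auto simp: bij_betw_def)
  define f where "f = represented Q h"
  have f: "f \<in> carrier thompson_G"
    unfolding f_def using hQ R by (intro represented_in_carrier Q mQ) auto
  have fq: "f q = Some (h q)" if "q \<in> Q" for q
    unfolding f_def using hQ R that by (intro represented_eq_Some Q mQ) auto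
  have "preserves sorted f"
    unfolding f_def represented_def using hQ R h(2)
    by (intro preserves_max_ext stable_sorted preserves_sorted_code_ext fg_essential_iso_code_ext Q mQ) auto
  then have "f \<in> thompson_F" using f by (simp add: thompson_F_eq)
  define \<pi> where "\<pi> = g \<otimes>\<^bsub>thompson_G\<^esub> inv\<^bsub>thompson_G\<^esub> f"
  \<comment> \<open>As \<open>h\<close> and \<open>g\<close> both map \<open>Q\<close> onto
    \<open>R\<close>, the rule \<open>h q\<close> to \<open>g q\<close> describes a permutation of
    \<open>R\<close>.\<close>
  have \<pi>h: "\<pi> (h q) = Some (the (g q))" if "q \<in> Q" for q
    unfolding \<pi>_def
  proof (rule thompson_G_mult_eq_Some[OF g])
    show "(inv\<^bsub>thompson_G\<^esub> f) (h q) = Some q" by (simp add: thompson_G_inv_eq_Some_iff f fq that)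
    show "g q = Some (the (g q))" using that \<open>Q \<subseteq> dom g\<close> by auto
  qed (use f in simp)
  have "(\<lambda>x. the (\<pi> x)) ` R = (\<lambda>q. the (g q)) ` Q"
    using \<pi>h unfolding hQ(1)[symmetric] image_image by simp
  then have "(\<lambda>x. the (\<pi> x)) ` R = R" using gQ by simp
  moreover have "R \<subseteq> dom \<pi>" using \<pi>h hQ(1) by auto
  moreover have "\<pi> \<in> carrier thompson_G" using g f by (simp add: \<pi>_def)
  ultimately have "\<pi> \<in> Sym_code R" using Sym_code_iff[OF R] by blast
  then have "\<pi> \<in> Sym_union P" using n(1) by (auto simp: Sym_union_def R_def)
  moreover have "g = \<pi> \<otimes>\<^bsub>thompson_G\<^esub> f" using g f by (simp add: \<pi>_def m_assoc)
  ultimately show ?thesis using \<open>f \<in> thompson_F\<close> by blast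
qed

text \<open>From \<open>h k = h' k'\<close> the element with the two expressions
  \<open>inv h' h\<close> and \<open>k' inv k\<close> lies in both subgroups, hence is
  trivial.\<close>

lemma (in group) subgroup_factorization_unique:
  assumes "subgroup H G" "subgroup K G" "H \<inter> K = {\<one>}"
    and "h \<in> H" "h' \<in> H" "k \<in> K" "k' \<in> K" "h \<otimes> k = h' \<otimes> k'"
  shows "h = h' \<and> k = k'"
proof -
  have car: "h \<in> carrier G" "h' \<in> carrier G" "k \<in> carrier G" "k' \<in> carrier G"
    using assms subgroup.subset by blast+
  then have "inv h' \<otimes> h = inv h' \<otimes> (h \<otimes> k) \<otimes> inv k" by (simp add: m_assoc)
  also have "\<dots> = k' \<otimes> inv k" using car assms(8) by (simp add: m_assoc[symmetric])
  finally have eq: "inv h' \<otimes> h = k' \<otimes> inv k" .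
  have "inv h' \<otimes> h \<in> H" "k' \<otimes> inv k \<in> K"
    using assms by (auto intro: subgroup.m_closed subgroup.m_inv_closed)
  then have "inv h' \<otimes> h = \<one>" using eq assms(3) by auto
  then have "h = h'" using car by (metis inv_equality inv_inv inv_closed)
  then show ?thesis using car assms(8) by simp
qed

theorem theorem4p1:
  fixes P :: "'a::{finite,linorder} list set"
    and k :: nat
  assumes "card (UNIV :: 'a set) = k" and "k \<ge> 2"
    and "finite P" and "maximal_prefix_code P"
  shows "group (thompson_G :: ('a list \<rightharpoonup> 'a list) monoid)
    \<and> subgroup (Sym_union P) thompson_G
    \<and> carrier thompson_G = Sym_union P <#>\<^bsub>thompson_G\<^esub> thompson_F
    \<and> Sym_union P \<inter> thompson_F = {\<one>\<^bsub>thompson_G\<^esub>}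
    \<and> (\<forall>g\<in>carrier (thompson_G :: ('a list \<rightharpoonup> 'a list) monoid).
         \<exists>!(\<pi>, f). \<pi> \<in> Sym_union P \<and> f \<in> thompson_F \<and> g = \<pi> \<otimes>\<^bsub>thompson_G\<^esub> f)
    \<and> subgroup (thompson_T :: ('a list \<rightharpoonup> 'a list) set) thompson_G
    \<and> subgroup (Cyc_union P) (thompson_G\<lparr>carrier := thompson_T\<rparr>)
    \<and> thompson_T = Cyc_union P <#>\<^bsub>thompson_G\<^esub> thompson_F
    \<and> (\<forall>t\<in>(thompson_T :: ('a list \<rightharpoonup> 'a list) set).
         \<exists>!(\<zeta>, f). \<zeta> \<in> Cyc_union P \<and> f \<in> thompson_F \<and> t = \<zeta> \<otimes>\<^bsub>thompson_G\<^esub> f)"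
proof -
  interpret group "thompson_G :: ('a list \<rightharpoonup> 'a list) monoid" by (rule group_thompson_G)
  note P = \<open>finite P\<close> \<open>maximal_prefix_code P\<close>
  note S = subgroup_Sym_union[OF P] and F = subgroup_thompson_F[where 'a = 'a]
    and T = subgroup_thompson_T[where 'a = 'a]
  note Z_eq = Cyc_union_eq[OF P] and FT = thompson_F_subset_T[where 'a = 'a]
  \<comment> \<open>Closure of the union of cyclic groups comes from its description as an
    intersection of two subgroups.\<close>
  have Z: "subgroup (Cyc_union P) thompson_G" unfolding Z_eq by (intro subgroups_Inter_pair S T)
  have SF: "Sym_union P \<inter> thompson_F = {\<one>\<^bsub>thompson_G\<^esub>}"
  proof
    show "Sym_union P \<inter> thompson_F \<subseteq> {\<one>\<^bsub>thompson_G\<^esub>}"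
      using Sym_code_Int_thompson_F[OF finite_code_power[OF P(1)] maximal_prefix_code_code_power[OF P]]
      by (auto simp: Sym_union_def one_thompson_G)
    show "{\<one>\<^bsub>thompson_G\<^esub>} \<subseteq> Sym_union P \<inter> thompson_F"
      using subgroup.one_closed[OF S] subgroup.one_closed[OF F] by simp
  qed
  have T_factorization: "\<exists>\<zeta>\<in>Cyc_union P. \<exists>f\<in>thompson_F. t = \<zeta> \<otimes>\<^bsub>thompson_G\<^esub> f" if t: "t \<in> thompson_T" for t
  proof -
    have "t \<in> carrier thompson_G" using t subgroup.subset[OF T] by blast
    then obtain \<pi> f where *: "\<pi> \<in> Sym_union P" "f \<in> thompson_F" "t = \<pi> \<otimes>\<^bsub>thompson_G\<^esub> f"
      using thompson_G_factorization[OF P] by blast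
    have "\<pi> = t \<otimes>\<^bsub>thompson_G\<^esub> inv\<^bsub>thompson_G\<^esub> f"
      using * subgroup.mem_carrier[OF S] subgroup.mem_carrier[OF F] by (simp add: m_assoc)
    then have "\<pi> \<in> thompson_T"
      using t *(2) FT subgroup.m_closed[OF T] subgroup.m_inv_closed[OF T] by auto
    then show ?thesis using * Z_eq by blast
  qed
  \<comment> \<open>Stated for any subset \<open>H\<close> of \<open>S\<close>, so that uniqueness
    over \<open>Z\<close> is a special case of uniqueness over \<open>S\<close>.\<close>
  have ex1: "\<exists>!(h, f). h \<in> H \<and> f \<in> thompson_F \<and> g = h \<otimes>\<^bsub>thompson_G\<^esub> f"
    if HS: "H \<subseteq> Sym_union P" and ex: "\<exists>h\<in>H. \<exists>f\<in>thompson_F. g = h \<otimes>\<^bsub>thompson_G\<^esub> f" for H g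
  proof -
    obtain h f where hf: "h \<in> H" "f \<in> thompson_F" "g = h \<otimes>\<^bsub>thompson_G\<^esub> f" using ex by blast
    show ?thesis
    proof (rule ex1I[of _ "(h, f)"])
      fix p assume "case p of (h, f) \<Rightarrow> h \<in> H \<and> f \<in> thompson_F \<and> g = h \<otimes>\<^bsub>thompson_G\<^esub> f"
      then show "p = (h, f)"
        using subgroup_factorization_unique[OF S F SF, of "fst p" h "snd p" f] hf HS by (cases p) auto
    qed (use hf in simp)
  qed
  have G_eq: "carrier thompson_G = Sym_union P <#>\<^bsub>thompson_G\<^esub> thompson_F"
  proof
    show "carrier thompson_G \<subseteq> Sym_union P <#>\<^bsub>thompson_G\<^esub> thompson_F"
      using thompson_G_factorization[OF P] unfolding set_mult_def by blast
    show "Sym_union P <#>\<^bsub>thompson_G\<^esub> thompson_F \<subseteq> carrier thompson_G"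
      by (intro set_mult_closed subgroup.subset S F)
  qed
  have T_eq: "thompson_T = Cyc_union P <#>\<^bsub>thompson_G\<^esub> thompson_F"
  proof
    show "thompson_T \<subseteq> Cyc_union P <#>\<^bsub>thompson_G\<^esub> thompson_F"
      using T_factorization unfolding set_mult_def by blast
    show "Cyc_union P <#>\<^bsub>thompson_G\<^esub> thompson_F \<subseteq> thompson_T"
      using FT subgroup.m_closed[OF T] by (auto simp: set_mult_def Z_eq)
  qed
  have "subgroup (Cyc_union P) (thompson_G\<lparr>carrier := thompson_T\<rparr>)"
    using Z T by (intro subgroup_incl) (auto simp: Z_eq)
  then show ?thesis
    using is_group S G_eq SF T T_eq ex1[of "Sym_union P"] ex1[of "Cyc_union P"] thompson_G_factorization[OF P]
      T_factorization Z_eq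
    by (intro conjI ballI) auto
qed

end
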